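(* Let $q$ be a prime power and let $k\ge 0$ be an integer. For each integer $n\ge 1$, let $\lambda_{q,n,k}$ be the number of elements $\alpha\in\mathbb{F}_{q^n}$ that are $k$-normal over $\mathbb{F}_q$, and set $\lambda_{q,k}(n)=\frac{\lambda_{q,n,k}}{q^n}$. Then there exists a real number $\overline{\lambda}_{q,k}\ge 0$ such that $$\overline{\lambda}_{q,k}=\lim_{t\to+\infty}\frac{1}{t}\sum_{1\le n\le t}\lambda_{q,k}(n).$$
   Context: $\mathbb{F}_{q^n}$ denotes the finite field with $q^n$ elements, viewed as an $\mathbb{F}_q$-vector space of dimension $n$. For an integer $0\le k\le n$, an element $\alpha\in\mathbb{F}_{q^n}$ is called $k$-normal over $\mathbb{F}_q$ if the $\mathbb{F}_q$-vector space generated by the set $\{\alpha,\alpha^q,\ldots,\alpha^{q^{n-1}}\}$ has dimension $n-k$. If $k>n$, no element of $\mathbb{F}_{q^n}$ is $k$-normal, so $\lambda_{q,n,k}=0$. The variable $t$ is a real number tending to infinity and $n$ ranges over positive integers. *)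

theory Defs
  imports
    Complex_Main
    "HOL-Algebra.Embedded_Algebras"
    "HOL-Number_Theory.Prime_Powers"
begin

text \<open>
  A model of the extension of finite fields of orders \<open>q\<close> and \<open>q ^ n\<close>: the field \<open>K\<close>
  has \<open>q ^ n\<close> elements and \<open>F\<close> is its subfield with \<open>q\<close> elements. For a prime power \<open>q\<close>
  and \<open>n \<ge> 1\<close> such a pair is unique up to isomorphism.
\<close>
definition finite_field_ext :: "nat \<Rightarrow> nat \<Rightarrow> ('a, 'b) ring_scheme \<Rightarrow> 'a set \<Rightarrow> bool" where
  "finite_field_ext q n K F \<longleftrightarrow>
     field K \<and> card (carrier K) = q ^ n \<and> subfield F K \<and> card F = q"

text \<open>The conjunct \<open>k \<le> n\<close> is needed because subtraction on the naturals truncates.\<close>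
definition k_normal ::
    "nat \<Rightarrow> nat \<Rightarrow> nat \<Rightarrow> ('a, 'b) ring_scheme \<Rightarrow> 'a set \<Rightarrow> 'a \<Rightarrow> bool" where
  "k_normal q n k K F \<alpha> \<longleftrightarrow>
     k \<le> n \<and>
     ring.dimension K (n - k) F (ring.Span K F (map (\<lambda>i. \<alpha> [^]\<^bsub>K\<^esub> (q ^ i)) [0..<n]))"

definition k_normal_count ::
    "nat \<Rightarrow> nat \<Rightarrow> nat \<Rightarrow> ('a, 'b) ring_scheme \<Rightarrow> 'a set \<Rightarrow> nat" where
  "k_normal_count q n k K F = card {\<alpha> \<in> carrier K. k_normal q n k K F \<alpha>}"

definition k_normal_density ::
    "nat \<Rightarrow> nat \<Rightarrow> nat \<Rightarrow> ('a, 'b) ring_scheme \<Rightarrow> 'a set \<Rightarrow> real" where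
  "k_normal_density q n k K F = real (k_normal_count q n k K F) / real q ^ n"

end

theory Submission
  imports
    Defs
    "HOL-Algebra.Multiplicative_Group"
    "HOL-Number_Theory.Number_Theory"
    "HOL-Computational_Algebra.Polynomial"
    "HOL-Real_Asymp.Real_Asymp"
begin

text \<open>
  Write \<open>\<sigma>\<close> for the \<open>q\<close>-power map on the field \<open>K\<close> with \<open>q ^ n\<close> elements, and
  call an \<open>F\<close>-subspace a submodule if it is \<open>\<sigma>\<close>-stable. An element is \<open>k\<close>-normal iff the submodule it
  generates has \<open>q ^ (n - k)\<close> elements. For \<open>d dvd n\<close> with \<open>n div d\<close> prime to \<open>q\<close> let
  \<open>U\<close> be the kernel of the trace onto the subfield with \<open>q ^ d\<close> elements. If \<open>\<alpha>\<close> generates a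
  submodule containing \<open>U\<close>, then \<open>\<alpha>\<close> and its trace have the same defect \<open>k\<close>. Otherwise
  \<open>\<alpha>\<close> lies in the image of an operator whose kernel is a simple submodule \<open>W\<close> of \<open>U\<close>, and this
  image has density \<open>1 / card W\<close>. If \<open>\<sigma>\<close> has order \<open>e\<close> on \<open>W\<close>, then \<open>e\<close> divides \<open>n\<close> but not \<open>d\<close>,
  and \<open>card W \<ge> q ^ ord e q\<close>; there are at most \<open>e\<close> such \<open>W\<close>. Hence the densities for \<open>n\<close> and \<open>d\<close>
  differ by at most the sum of \<open>e / q ^ ord e q\<close> over these \<open>e\<close>.

  On average over \<open>n\<close> this error is at most a tail of the sum of \<open>1 / q ^ ord e q\<close>, which converges
  because \<open>e\<close> divides \<open>q ^ ord e q - 1\<close>. So the density is a uniform limit in mean of the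
  periodic functions obtained by replacing \<open>n\<close> by \<open>gcd n M\<close>, which have mean values. Comparing
  different \<open>n\<close> uses that the density depends on \<open>q\<close>, \<open>n\<close>, \<open>k\<close> only, that is, the uniqueness of finite fields.
\<close>

section \<open>Integer polynomials in finite fields\<close>

context cring
begin

lemma int_add_pow_0 [simp]: "[(0::int)] \<cdot> x = \<zero>"
  by (simp add: add_pow_def)

text \<open>Integer coefficients allow one and the same polynomial to be evaluated in two fields of
  different types, which is how the elements of two finite fields are matched.\<close>

definition ipoly_eval :: "'a \<Rightarrow> int poly \<Rightarrow> 'a" where
  "ipoly_eval a g = fold_coeffs (\<lambda>c v. [c] \<cdot> \<one> \<oplus> a \<otimes> v) g \<zero>"

lemma ipoly_eval_0 [simp]: "ipoly_eval a 0 = \<zero>"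
  by (simp add: ipoly_eval_def)

lemma ipoly_eval_pCons:
  assumes [simp]: "a \<in> carrier R"
  shows "ipoly_eval a (pCons c g) = [c] \<cdot> \<one> \<oplus> a \<otimes> ipoly_eval a g"
  by (cases "c = 0 \<and> g = 0") (auto simp: ipoly_eval_def fold_coeffs_def cCons_def)

lemma ipoly_eval_closed [simp]:
  assumes [simp]: "a \<in> carrier R"
  shows "ipoly_eval a g \<in> carrier R"
  by (induction g) (simp_all add: ipoly_eval_pCons)

lemma ipoly_eval_add:
  assumes [simp]: "a \<in> carrier R"
  shows "ipoly_eval a (g + h) = ipoly_eval a g \<oplus> ipoly_eval a h"
proof (induction g arbitrary: h)
  case 0
  then show ?case by simp
next
  case (pCons c g)
  obtain d h' where h: "h = pCons d h'" by (cases h)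
  have "[(c + d)] \<cdot> \<one> \<oplus> a \<otimes> (ipoly_eval a g \<oplus> ipoly_eval a h')
      = [c] \<cdot> \<one> \<oplus> a \<otimes> ipoly_eval a g \<oplus> ([d] \<cdot> \<one> \<oplus> a \<otimes> ipoly_eval a h')"
    by (simp add: add.int_pow_mult r_distr a_ac)
  then show ?case by (simp add: h ipoly_eval_pCons pCons.IH)
qed

lemma ipoly_eval_smult:
  assumes [simp]: "a \<in> carrier R"
  shows "ipoly_eval a (Polynomial.smult c g) = [c] \<cdot> \<one> \<otimes> ipoly_eval a g"
proof (induction g)
  case 0
  then show ?case by simp
next
  case (pCons d g)
  have "[(c * d)] \<cdot> \<one> = [c] \<cdot> \<one> \<otimes> ([d] \<cdot> \<one>)"
    by (simp add: add_pow_ldistr_int add.int_pow_pow mult.commute)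
  then show ?case by (simp add: ipoly_eval_pCons pCons.IH r_distr m_lcomm)
qed

lemma ipoly_eval_mult:
  assumes [simp]: "a \<in> carrier R"
  shows "ipoly_eval a (g * h) = ipoly_eval a g \<otimes> ipoly_eval a h"
  by (induction g)
    (simp_all add: ipoly_eval_pCons ipoly_eval_add ipoly_eval_smult l_distr m_assoc)

lemma ipoly_eval_const:
  assumes [simp]: "a \<in> carrier R"
  shows "ipoly_eval a [:c:] = [c] \<cdot> \<one>"
  by (simp add: ipoly_eval_pCons)

lemma ipoly_eval_1 [simp]:
  assumes [simp]: "a \<in> carrier R"
  shows "ipoly_eval a 1 = \<one>"
  by (simp add: one_pCons ipoly_eval_const)

lemma ipoly_eval_power:
  assumes [simp]: "a \<in> carrier R"
  shows "ipoly_eval a (g ^ m) = ipoly_eval a g [^] m"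
  by (induction m) (simp_all add: ipoly_eval_mult m_comm)

lemma ipoly_eval_X:
  assumes [simp]: "a \<in> carrier R"
  shows "ipoly_eval a [:0, 1:] = a"
  by (simp add: ipoly_eval_pCons)

lemma ipoly_eval_minus:
  assumes [simp]: "a \<in> carrier R"
  shows "ipoly_eval a (g - h) = ipoly_eval a g \<ominus> ipoly_eval a h"
proof -
  have "ipoly_eval a (g - h) \<oplus> ipoly_eval a h = ipoly_eval a g"
    by (simp flip: ipoly_eval_add)
  then show ?thesis
    by (metis a_minus_def add.inv_solve_right assms ipoly_eval_closed)
qed

lemma ipoly_eval_dvd:
  assumes [simp]: "a \<in> carrier R" and "g dvd h" "ipoly_eval a g = \<zero>"
  shows "ipoly_eval a h = \<zero>"
  using assms(2,3) by (auto simp: dvd_def ipoly_eval_mult)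

end

section \<open>Additivity of the Frobenius map\<close>

text \<open>All inner binomial coefficients \<open>p choose i\<close> are divisible by
  \<open>p\<close>. In this form the fact can be evaluated at any element of a ring in which
  \<open>p\<close> vanishes.\<close>

lemma prime_dvd_binomial_poly:
  fixes p :: nat
  assumes "prime p"
  shows "[:of_nat p:] dvd ([:1, 1:] ^ p - [:0, 1:] ^ p - 1 :: int poly)"
proof -
  have "p \<ge> 2" using assms prime_ge_2_nat by blast
  have split: "{..p} = insert 0 (insert p {0<..<p})" using \<open>p \<ge> 2\<close> by auto
  have "[:1, 1:] ^ p = ([:0, 1:] + 1 :: int poly) ^ p"
    by (simp add: one_pCons)
  also have "\<dots> = (\<Sum>i\<le>p. of_nat (p choose i) * [:0, 1:] ^ i)"
    by (simp add: binomial_ring)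
  also have "\<dots> = 1 + ([:0, 1:] ^ p + (\<Sum>i\<in>{0<..<p}. of_nat (p choose i) * [:0, 1:] ^ i))"
    unfolding split using \<open>p \<ge> 2\<close> by (subst sum.insert; simp)
  finally have "[:1, 1:] ^ p - [:0, 1:] ^ p - 1
      = (\<Sum>i\<in>{0<..<p}. of_nat (p choose i) * [:0, 1:] ^ i :: int poly)" by simp
  moreover have "[:of_nat p:] dvd (of_nat (p choose i) * [:0, 1:] ^ i :: int poly)" if "i \<in> {0<..<p}" for i
  proof (rule dvd_mult2)
    have "p dvd p choose i" using that assms by (intro dvd_choose_prime) auto
    then show "[:of_nat p:] dvd (of_nat (p choose i) :: int poly)"
      by (metis of_nat_dvd_iff of_nat_poly of_nat_mult dvd_def)
  qed
  ultimately show ?thesis by (metis (no_types, lifting) dvd_sum)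
qed

text \<open>By homogeneity the case \<open>y = \<one>\<close> is enough: divide by \<open>y\<close>
  and evaluate the binomial polynomial at the quotient \<open>z\<close>.\<close>

lemma (in field) freshmans_dream_prime:
  assumes p: "prime (p :: nat)" and char: "[p] \<cdot> \<one> = \<zero>"
    and [simp]: "x \<in> carrier R" "y \<in> carrier R"
  shows "(x \<oplus> y) [^] p = x [^] p \<oplus> y [^] p"
proof (cases "y = \<zero>")
  case True
  then show ?thesis using p prime_gt_0_nat[of p] by (simp add: nat_pow_zero)
next
  case False
  define z where "z = x \<otimes> inv y"
  have inv: "inv y \<in> carrier R" "y \<otimes> inv y = \<one>"
    using False field_Units by auto
  have z [simp]: "z \<in> carrier R" using inv by (simp add: z_def)
  have x: "x = z \<otimes> y" using inv by (simp add: z_def m_assoc m_comm[of "inv y" y])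
  have "ipoly_eval z [:of_nat p:] = \<zero>"
    using char by (simp add: ipoly_eval_const add_pow_def int_pow_int)
  then have "ipoly_eval z ([:1, 1:] ^ p - [:0, 1:] ^ p - 1) = \<zero>"
    using ipoly_eval_dvd[OF z prime_dvd_binomial_poly[OF p]] by simp
  then have "(z \<oplus> \<one>) [^] p \<ominus> z [^] p \<ominus> \<one> = \<zero>"
    by (simp add: ipoly_eval_minus ipoly_eval_power ipoly_eval_pCons a_comm)
  then have "(z \<oplus> \<one>) [^] p = z [^] p \<oplus> \<one>"
    by (metis (no_types, lifting) a_minus_def add.inv_solve_right' l_zero minus_closed nat_pow_closed one_closed r_right_minus_eq z add.m_closed a_comm)
  then have "(z \<oplus> \<one>) [^] p \<otimes> y [^] p = z [^] p \<otimes> y [^] p \<oplus> y [^] p"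
    by (simp add: l_distr)
  moreover have "x \<oplus> y = (z \<oplus> \<one>) \<otimes> y" by (simp add: x l_distr)
  ultimately show ?thesis by (simp add: x nat_pow_distrib)
qed

text \<open>By Lagrange in the additive group, \<open>p ^ a\<close> times \<one> vanishes. This is
  the \<open>a\<close>-th power of \<open>p\<close> times \<one>, and a field has no nonzero
  nilpotents.\<close>

lemma (in field) additive_char:
  assumes "card (carrier R) = p ^ a" "prime (p :: nat)"
  shows "[p] \<cdot> \<one> = \<zero>"
proof -
  have "[(Coset.order (add_monoid R))] \<cdot> \<one> = \<zero>"
    using add.pow_order_eq_1[of \<one>] by simp
  then have *: "[(p ^ a)] \<cdot> \<one> = \<zero>" using assms by (simp add: Coset.order_def)
  have pow: "[(p ^ j)] \<cdot> \<one> = ([p] \<cdot> \<one>) [^] j" for j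
  proof (induction j)
    case (Suc j)
    have "[(p * p ^ j)] \<cdot> \<one> = [(p ^ j)] \<cdot> \<one> \<otimes> [p] \<cdot> \<one>"
      by (simp add: add_pow_ldistr add.nat_pow_pow mult.commute)
    then show ?case by (simp add: Suc)
  qed simp
  have zero: "x = \<zero>" if "x [^] j = \<zero>" "x \<in> carrier R" for x and j :: nat
    using that by (induction j) (auto simp: integral_iff)
  show ?thesis using * unfolding pow by (auto intro: zero)
qed

lemma (in field) freshmans_dream:
  assumes "card (carrier R) = p ^ a" "prime (p :: nat)"
    and [simp]: "x \<in> carrier R" "y \<in> carrier R"
  shows "(x \<oplus> y) [^] (p ^ j) = x [^] (p ^ j) \<oplus> y [^] (p ^ j)"
  using assms(3,4)
proof (induction j arbitrary: x y)
  case (Suc j)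
  show ?case
    using Suc freshmans_dream_prime[OF assms(2) additive_char[OF assms(1,2)]]
    by (simp flip: nat_pow_pow)
qed simp

section \<open>Root bounds and the kernel of evaluation\<close>

lemma (in field) finite_roots_card_le:
  assumes "finite (carrier R)" and f: "f \<in> carrier (UP R)"
    and "UnivPoly.coeff (UP R) f i \<noteq> \<zero>"
    and "\<And>j. D < j \<Longrightarrow> UnivPoly.coeff (UP R) f j = \<zero>"
  shows "card {x \<in> carrier R. eval R R id x f = \<zero>} \<le> D"
proof -
  interpret U: UP_domain R "UP R" by unfold_locales simp
  have "f \<noteq> \<zero>\<^bsub>UP R\<^esub>" using assms(3) by auto
  then have "card {x \<in> carrier R. eval R R id x f = \<zero>} \<le> deg R f"
    using U.roots_bound[OF f] assms(1) by blast
  also have "\<dots> \<le> D" using assms(4) f by (rule U.deg_aboveI)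
  finally show ?thesis .
qed

text \<open>Carries integer polynomials over to the polynomial ring \<open>UP R\<close>, whose root
  bound then applies to them.\<close>

lemma (in field) ipoly_eval_as_UP:
  "\<exists>f \<in> carrier (UP R). (\<forall>i. UnivPoly.coeff (UP R) f i = [(Polynomial.coeff g i)] \<cdot> \<one>) \<and>
     (\<forall>b \<in> carrier R. eval R R id b f = ipoly_eval b g)"
proof (induction g)
  case 0
  interpret U: UP_domain R "UP R" by unfold_locales simp
  have "eval R R id b \<zero>\<^bsub>UP R\<^esub> = \<zero>" if "b \<in> carrier R" for b
    using U.evalRR_monom[OF zero_closed that, of 0] that by simp
  then show ?case by (intro bexI[of _ "\<zero>\<^bsub>UP R\<^esub>"]) (auto simp: id_def)
next
  case (pCons c g)
  interpret U: UP_domain R "UP R" by unfold_locales simp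
  from pCons obtain f where f: "f \<in> carrier (UP R)"
    "\<And>i. UnivPoly.coeff (UP R) f i = [(Polynomial.coeff g i)] \<cdot> \<one>"
    "\<And>b. b \<in> carrier R \<Longrightarrow> eval R R id b f = ipoly_eval b g" by blast
  define m where "m = UnivPoly.monom (UP R) \<one> 1 \<otimes>\<^bsub>UP R\<^esub> f"
  have m: "m \<in> carrier (UP R)" using f by (simp add: m_def)
  define h where "h = UnivPoly.monom (UP R) ([c] \<cdot> \<one>) 0 \<oplus>\<^bsub>UP R\<^esub> m"
  have "UnivPoly.coeff (UP R) m 0 = \<zero>"
    using f by (simp add: m_def)
  moreover have "UnivPoly.coeff (UP R) m (Suc i) = [(Polynomial.coeff g i)] \<cdot> \<one>" for i
    using U.coeff_monom_mult[OF one_closed f(1), of 1 i] f by (simp add: m_def)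
  ultimately have "UnivPoly.coeff (UP R) h i = [(Polynomial.coeff (pCons c g) i)] \<cdot> \<one>" for i
    using m by (cases i) (simp_all add: h_def)
  moreover have "eval R R id b h = ipoly_eval b (pCons c g)" if "b \<in> carrier R" for b
    using that m f unfolding h_def
    by (simp add: U.evalRR_simps ipoly_eval_pCons m_def del: One_nat_def)
  ultimately show ?case
    using m by (intro bexI[of _ h]) (auto simp: h_def id_def)
qed

lemma (in field) ipoly_roots_card_le:
  assumes "finite (carrier R)" "lead_coeff g = 1"
  shows "card {b \<in> carrier R. ipoly_eval b g = \<zero>} \<le> Polynomial.degree g"
proof -
  obtain f where f: "f \<in> carrier (UP R)"
    "\<And>i. UnivPoly.coeff (UP R) f i = [(Polynomial.coeff g i)] \<cdot> \<one>"
    "\<And>b. b \<in> carrier R \<Longrightarrow> eval R R id b f = ipoly_eval b g"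
    using ipoly_eval_as_UP by blast
  have "{b \<in> carrier R. ipoly_eval b g = \<zero>} = {b \<in> carrier R. eval R R id b f = \<zero>}"
    using f(3) by auto
  also have "card \<dots> \<le> Polynomial.degree g"
    using assms by (intro finite_roots_card_le[OF _ f(1), where i = "Polynomial.degree g"])
      (auto simp: f(2) coeff_eq_0)
  finally show ?thesis .
qed

text \<open>Pseudo-division multiplies the dividend by a power of the leading coefficient, so for a
  monic divisor it is true division over the integers.\<close>

lemma ipoly_monic_div:
  fixes f h :: "int poly"
  assumes "lead_coeff f = 1"
  obtains s r where "h = f * s + r" "r = 0 \<or> Polynomial.degree r < Polynomial.degree f"
proof -
  have "f \<noteq> 0" using assms by auto
  moreover obtain s r where "pseudo_divmod h f = (s, r)" by force
  ultimately show ?thesis using that pseudo_divmod[of f h s r] assms by simp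
qed

text \<open>The kernel of evaluation at a generator is generated by \<open>p\<close> and a monic polynomial
  of minimal degree.\<close>
lemma (in field) ipoly_kernel:
  assumes char: "[p] \<cdot> \<one> = \<zero>" and p: "prime (p :: nat)" and a: "a \<in> carrier R"
    and g: "lead_coeff g = 1" "ipoly_eval a g = \<zero>"
  obtains f where "lead_coeff f = 1" "ipoly_eval a f = \<zero>" "Polynomial.degree f > 0"
    "\<And>h. ipoly_eval a h = \<zero> \<Longrightarrow> \<exists>s r t. h = f * s + r \<and> r = [:of_nat p:] * t \<and>
        (r = 0 \<or> Polynomial.degree r < Polynomial.degree f)"
proof -
  define Q where "Q f \<longleftrightarrow> lead_coeff f = 1 \<and> ipoly_eval a f = \<zero>" for f
  obtain f where f: "Q f" and min: "\<And>h. Q h \<Longrightarrow> Polynomial.degree f \<le> Polynomial.degree h"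
    using ex_has_least_nat[of Q g Polynomial.degree] g unfolding Q_def by blast
  have p0: "ipoly_eval a ([:of_nat p:] * h) = \<zero>" for h
    using char a by (simp add: ipoly_eval_mult ipoly_eval_const add_pow_def int_pow_int del: mult_pCons_left)
  \<comment> \<open>Induction on the degree. If \<open>p\<close> divides the leading coefficient
    \<open>c\<close>, the leading term is a multiple of \<open>p\<close> and can be subtracted.
    Otherwise Bezout coefficients for \<open>c\<close> and \<open>p\<close> give a monic kernel
    element of the same degree, against the minimality of \<open>f\<close>.\<close>
  have small: "[:of_nat p:] dvd r" if "ipoly_eval a r = \<zero>" "Polynomial.degree r < Polynomial.degree f" for r
    using that
  proof (induction "Polynomial.degree r" arbitrary: r rule: less_induct)
    case less
    show ?case
    proof (cases "r = 0")
      case False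
      define c where "c = lead_coeff r"
      let ?d = "Polynomial.degree r"
      show ?thesis
      proof (cases "int p dvd c")
        case True
        then obtain e where e: "c = int p * e" by blast
        define l where "l = Polynomial.monom c ?d"
        have l: "l = [:of_nat p:] * Polynomial.monom e ?d"
          by (simp add: l_def e smult_monom)
        define r' where "r' = r - l"
        have ev: "ipoly_eval a r' = \<zero>"
          using less.prems a by (simp add: r'_def ipoly_eval_minus l p0 del: mult_pCons_left)
        have "[:of_nat p:] dvd r'"
        proof (cases "r' = 0")
          case False
          have "Polynomial.degree r' \<le> ?d"
            unfolding r'_def l_def by (intro degree_diff_le degree_monom_le) simp
          moreover have "Polynomial.coeff r' ?d = 0" by (simp add: r'_def l_def c_def)
          ultimately have "Polynomial.degree r' < ?d"
            using False by (metis le_neq_implies_less leading_coeff_0_iff)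
          then show ?thesis using less.hyps[of r'] ev less.prems by simp
        qed simp
        then have "[:of_nat p:] dvd r' + l" unfolding l by (intro dvd_add dvd_triv_left)
        then show ?thesis by (simp add: r'_def)
      next
        case False
        have "coprime (int p) c"
          using False p by (simp add: prime_imp_coprime)
        then obtain u v where uv: "u * c + v * int p = 1"
          using bezout_int[of c "int p"] by (metis coprime_iff_gcd_eq_1 gcd.commute)
        define r' where "r' = Polynomial.smult u r + [:of_nat p:] * Polynomial.monom v ?d"
        have "ipoly_eval a r' = \<zero>"
          using less.prems a
          by (simp add: r'_def ipoly_eval_add p0 ipoly_eval_smult del: mult_pCons_left)
        moreover have c1: "Polynomial.coeff r' ?d = 1"
          using uv by (simp add: r'_def c_def mult.commute)
        moreover have "Polynomial.degree r' \<le> ?d"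
          by (simp add: r'_def smult_monom degree_add_le degree_monom_le)
        ultimately have "Q r'" "Polynomial.degree r' = ?d"
          unfolding Q_def by (metis le_antisym le_degree zero_neq_one)+
        then show ?thesis using min[of r'] less.prems by simp
      qed
    qed simp
  qed
  show ?thesis
  proof (rule that[of f])
    show lf: "lead_coeff f = 1" "ipoly_eval a f = \<zero>" using f by (auto simp: Q_def)
    show "Polynomial.degree f > 0"
    proof (rule ccontr)
      assume "\<not> ?thesis"
      then have d: "Polynomial.degree f = 0" by simp
      have "f = 1" using degree_0_id[OF d] lf(1) unfolding d by (simp add: one_pCons)
      then show False using lf a by simp
    qed
    fix h assume h: "ipoly_eval a h = \<zero>"
    obtain s r where sr: "h = f * s + r" "r = 0 \<or> Polynomial.degree r < Polynomial.degree f"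
      using ipoly_monic_div[OF lf(1)] by metis
    then have "ipoly_eval a r = \<zero>" using h a lf by (simp add: ipoly_eval_add ipoly_eval_mult)
    then have "[:of_nat p:] dvd r" using small sr(2) by auto
    then show "\<exists>s r t. h = f * s + r \<and> r = [:of_nat p:] * t \<and>
        (r = 0 \<or> Polynomial.degree r < Polynomial.degree f)"
      using sr unfolding dvd_def by blast
  qed
qed

section \<open>Uniqueness of the field with \<open>p ^ m\<close> elements\<close>

lemma (in field) pow_card:
  assumes "finite (carrier R)" "x \<in> carrier R"
  shows "x [^] card (carrier R) = x"
proof (cases "x = \<zero>")
  case True
  have "card (carrier R) \<noteq> 0" using assms by auto
  then show ?thesis using True by (simp add: nat_pow_zero)
next
  case False
  interpret M: group "mult_of R" by (rule field_mult_group)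
  have "x [^]\<^bsub>mult_of R\<^esub> Coset.order (mult_of R) = \<one>"
    using M.pow_order_eq_1[of x] False assms by simp
  then have "x [^] (card (carrier R) - 1) = \<one>"
    using order_mult_of assms by (simp add: nat_pow_mult_of Coset.order_def)
  moreover have "card (carrier R) = Suc (card (carrier R) - 1)" using assms by (cases "card (carrier R)") auto
  ultimately show ?thesis using assms by (metis l_one nat_pow_Suc)
qed

text \<open>Every element of \<open>K\<close> is an integer polynomial in a generator
  \<open>a\<close> of the multiplicative group. If \<open>f\<close> is the monic polynomial that
  generates the kernel of evaluation at \<open>a\<close> together with \<open>p\<close>, and
  \<open>b\<close> is a root of \<open>f\<close> in \<open>K'\<close>, the map sends
  \<open>h(a)\<close> to \<open>h(b)\<close>. It is well defined by the description of the kernel,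
  injective because \<open>K\<close> is a field, and surjective by counting.\<close>

lemma finite_field_iso:
  fixes K :: "('a, 'b) ring_scheme" and K' :: "('c, 'd) ring_scheme"
  assumes "field K" "field K'" and cardK: "card (carrier K) = p ^ m" and cardK': "card (carrier K') = p ^ m"
    and p: "prime (p :: nat)"
  obtains \<phi> where "\<phi> \<in> ring_hom K K'" "bij_betw \<phi> (carrier K) (carrier K')"
proof -
  interpret K: field K by fact
  interpret K': field K' by fact
  have pos: "p ^ m > 0" using p by (simp add: prime_gt_0_nat)
  have fin: "finite (carrier K)" "finite (carrier K')"
    using cardK cardK' pos by (auto intro: card_ge_0_finite)
  have char: "[p] \<cdot>\<^bsub>K\<^esub> \<one>\<^bsub>K\<^esub> = \<zero>\<^bsub>K\<^esub>" "[p] \<cdot>\<^bsub>K'\<^esub> \<one>\<^bsub>K'\<^esub> = \<zero>\<^bsub>K'\<^esub>"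
    using K.additive_char[OF cardK p] K'.additive_char[OF cardK' p] .
  define N where "N = p ^ m"
  have "card {\<zero>\<^bsub>K\<^esub>, \<one>\<^bsub>K\<^esub>} \<le> N" unfolding N_def cardK[symmetric] using fin by (intro card_mono) auto
  then have N2: "N \<ge> 2" by simp
  obtain a where a: "a \<in> carrier K" and gen: "carrier K - {\<zero>\<^bsub>K\<^esub>} = {a [^]\<^bsub>K\<^esub> i | i::nat. i \<in> UNIV}"
    using K.finite_field_mult_group_has_gen[OF fin(1)] by (auto simp: nat_pow_mult_of)
  define G :: "int poly" where "G = [:0, 1:] ^ N - [:0, 1:]"
  have degG: "Polynomial.degree G = N" and leadG: "lead_coeff G = 1"
  proof -
    have X: "[:0, 1:] ^ N = (Polynomial.monom 1 N :: int poly)" by (simp add: monom_altdef)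
    have c: "Polynomial.coeff G N = 1" using N2 by (auto simp: G_def X coeff_pCons split: nat.split)
    moreover have "Polynomial.degree G \<le> N"
      unfolding G_def X using N2 by (intro degree_diff_le degree_monom_le) auto
    ultimately show "Polynomial.degree G = N" by (metis le_antisym le_degree zero_neq_one)
    with c show "lead_coeff G = 1" by simp
  qed
  have Gev: "K.ipoly_eval x G = \<zero>\<^bsub>K\<^esub>" if "x \<in> carrier K" for x
    using that K.pow_card[OF fin(1) that] cardK
    by (simp add: G_def K.ipoly_eval_minus K.ipoly_eval_power K.ipoly_eval_X N_def)
  have Gev': "K'.ipoly_eval x G = \<zero>\<^bsub>K'\<^esub>" if "x \<in> carrier K'" for x
    using that K'.pow_card[OF fin(2) that] cardK'
    by (simp add: G_def K'.ipoly_eval_minus K'.ipoly_eval_power K'.ipoly_eval_X N_def)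
  obtain f where f: "lead_coeff f = 1" "K.ipoly_eval a f = \<zero>\<^bsub>K\<^esub>" "Polynomial.degree f > 0"
    and ker: "\<And>h. K.ipoly_eval a h = \<zero>\<^bsub>K\<^esub> \<Longrightarrow> \<exists>s r t. h = f * s + r \<and> r = [:of_nat p:] * t \<and>
        (r = 0 \<or> Polynomial.degree r < Polynomial.degree f)"
    using K.ipoly_kernel[OF char(1) p a leadG Gev[OF a]] by blast
  have p0: "K'.ipoly_eval b ([:of_nat p:] * h) = \<zero>\<^bsub>K'\<^esub>" if "b \<in> carrier K'" for b h
    using char(2) that
    by (simp add: K'.ipoly_eval_mult K'.ipoly_eval_const add_pow_def int_pow_int del: mult_pCons_left)
  \<comment> \<open>The polynomial \<open>G = X^N - X\<close> vanishes on all of \<open>K'\<close>,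
    and \<open>G = f * s + p * t\<close>. Since \<open>f\<close> has positive degree,
    \<open>s\<close> is monic of degree below \<open>N\<close>; so some \<open>b\<close> is not a
    root of \<open>s\<close> and has to be a root of \<open>f\<close>.\<close>
  obtain b where b: "b \<in> carrier K'" "K'.ipoly_eval b f = \<zero>\<^bsub>K'\<^esub>"
  proof -
    obtain s r t where srt: "G = f * s + r" "r = [:of_nat p:] * t" "r = 0 \<or> Polynomial.degree r < Polynomial.degree f"
      using ker[OF Gev[OF a]] by blast
    have s0: "s \<noteq> 0"
    proof
      assume "s = 0"
      then have "G = [:of_nat p:] * t" using srt by simp
      then have "int p dvd lead_coeff G" by simp
      then show False using leadG p by (simp add: prime_gt_1_nat not_prime_unit)
    qed
    have f0: "f \<noteq> 0" using f by auto
    have dfs: "Polynomial.degree (f * s) = Polynomial.degree f + Polynomial.degree s"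
      using s0 f0 by (rule degree_mult_eq[rotated])
    have "Polynomial.degree G = Polynomial.degree f + Polynomial.degree s \<and> lead_coeff G = lead_coeff s"
    proof (cases "r = 0")
      case True
      then have "G = f * s" using srt(1) by simp
      then show ?thesis using dfs f(1) lead_coeff_mult[of f s] by simp
    next
      case False
      then have "Polynomial.degree r < Polynomial.degree (f * s)" using srt(3) dfs by simp
      then have "Polynomial.degree (f * s + r) = Polynomial.degree (f * s)"
        "lead_coeff (r + f * s) = lead_coeff (f * s)"
        by (rule degree_add_eq_left, rule lead_coeff_add_le)
      then show ?thesis
        using dfs f(1) lead_coeff_mult[of f s] unfolding srt(1) by (simp add: add.commute)
    qed
    then have degs: "Polynomial.degree s < N" and leads: "lead_coeff s = 1"
      using f degG leadG by auto
    have "card {b \<in> carrier K'. K'.ipoly_eval b s = \<zero>\<^bsub>K'\<^esub>} < card (carrier K')"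
      using K'.ipoly_roots_card_le[OF fin(2) leads] degs cardK' by (simp add: N_def)
    then have "{b \<in> carrier K'. K'.ipoly_eval b s = \<zero>\<^bsub>K'\<^esub>} \<noteq> carrier K'" by auto
    then obtain b where b: "b \<in> carrier K'" "K'.ipoly_eval b s \<noteq> \<zero>\<^bsub>K'\<^esub>" by auto
    have "K'.ipoly_eval b f \<otimes>\<^bsub>K'\<^esub> K'.ipoly_eval b s = \<zero>\<^bsub>K'\<^esub>"
      using Gev'[OF b(1)] b(1) p0[OF b(1)] unfolding srt(1) srt(2)
      by (simp add: K'.ipoly_eval_add K'.ipoly_eval_mult del: mult_pCons_left)
    then have "K'.ipoly_eval b f = \<zero>\<^bsub>K'\<^esub>" using b by (auto simp: K'.integral_iff)
    with b(1) show ?thesis by (rule that)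
  qed
  have surj: "\<exists>h. K.ipoly_eval a h = x" if "x \<in> carrier K" for x
  proof (cases "x = \<zero>\<^bsub>K\<^esub>")
    case False
    then have "x \<in> {a [^]\<^bsub>K\<^esub> i | i::nat. i \<in> UNIV}" unfolding gen[symmetric] using that by simp
    then obtain i :: nat where "x = a [^]\<^bsub>K\<^esub> i" by blast
    then have "K.ipoly_eval a ([:0, 1:] ^ i) = x" using a by (simp add: K.ipoly_eval_power K.ipoly_eval_X)
    then show ?thesis by (rule exI)
  next
    case True
    then show ?thesis by (intro exI[of _ 0]) simp
  qed
  define lift where "lift x = (SOME h. K.ipoly_eval a h = x)" for x
  have lift: "K.ipoly_eval a (lift x) = x" if "x \<in> carrier K" for x
    unfolding lift_def using surj[OF that] by (rule someI_ex)
  define \<phi> where "\<phi> x = K'.ipoly_eval b (lift x)" for x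
  have ker': "K'.ipoly_eval b h = \<zero>\<^bsub>K'\<^esub>" if h: "K.ipoly_eval a h = \<zero>\<^bsub>K\<^esub>" for h
  proof -
    obtain s t where h: "h = f * s + [:of_nat p:] * t" using ker[OF h] by blast
    show ?thesis unfolding h using b p0[OF b(1)]
      by (simp add: K'.ipoly_eval_add K'.ipoly_eval_mult del: mult_pCons_left)
  qed
  have eq: "K'.ipoly_eval b h = K'.ipoly_eval b h'" if "K.ipoly_eval a h = K.ipoly_eval a h'" for h h'
    using ker'[of "h - h'"] that a b by (simp add: K.ipoly_eval_minus K'.ipoly_eval_minus)
  have \<phi>: "\<phi> (K.ipoly_eval a h) = K'.ipoly_eval b h" for h
    unfolding \<phi>_def using lift a by (intro eq) simp
  have hom: "\<phi> \<in> ring_hom K K'"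
  proof (rule ring_hom_memI)
    show "\<phi> x \<in> carrier K'" for x unfolding \<phi>_def using b by simp
    show "\<phi> \<one>\<^bsub>K\<^esub> = \<one>\<^bsub>K'\<^esub>" using \<phi>[of 1] a b by simp
    fix x y assume "x \<in> carrier K" "y \<in> carrier K"
    then obtain h h' where "x = K.ipoly_eval a h" "y = K.ipoly_eval a h'" using surj by metis
    then show "\<phi> (x \<otimes>\<^bsub>K\<^esub> y) = \<phi> x \<otimes>\<^bsub>K'\<^esub> \<phi> y" "\<phi> (x \<oplus>\<^bsub>K\<^esub> y) = \<phi> x \<oplus>\<^bsub>K'\<^esub> \<phi> y"
      using a b by (simp_all add: \<phi> flip: K.ipoly_eval_mult K.ipoly_eval_add K'.ipoly_eval_mult K'.ipoly_eval_add)
  qed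
  interpret h: ring_hom_ring K K' \<phi>
    by (rule ring_hom_ringI2) (use hom K.ring_axioms K'.ring_axioms in auto)
  have inj: "inj_on \<phi> (carrier K)"
    using h.img_is_subfield(1)[OF K.carrier_is_subfield] by simp
  have "\<phi> ` carrier K = carrier K'"
    using hom inj fin by (intro card_subset_eq) (auto simp: card_image cardK cardK' ring_hom_closed)
  then show ?thesis using that hom inj by (auto simp: bij_betw_def)
qed

section \<open>Submodules generated by Frobenius orbits\<close>

text \<open>The module generated by \<alpha> over the polynomials in Frobenius; zero arises as
  \<zero> times \<alpha>. No rule mentions the carrier, so restricting to a subfield does not change
  the set, and isomorphisms transport it by rule induction.\<close>

inductive_set frob_span :: "nat \<Rightarrow> ('a, 'b) ring_scheme \<Rightarrow> 'a set \<Rightarrow> 'a \<Rightarrow> 'a set"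
  for q :: nat and K :: "('a, 'b) ring_scheme" (structure) and F :: "'a set" and \<alpha> :: 'a
  where
    frob_span_base: "\<alpha> \<in> frob_span q K F \<alpha>"
  | frob_span_add: "x \<in> frob_span q K F \<alpha> \<Longrightarrow> y \<in> frob_span q K F \<alpha> \<Longrightarrow> x \<oplus> y \<in> frob_span q K F \<alpha>"
  | frob_span_smult: "c \<in> F \<Longrightarrow> x \<in> frob_span q K F \<alpha> \<Longrightarrow> c \<otimes> x \<in> frob_span q K F \<alpha>"
  | frob_span_frob: "x \<in> frob_span q K F \<alpha> \<Longrightarrow> x [^] q \<in> frob_span q K F \<alpha>"

locale finite_ext = field K for K (structure) +
  fixes F q n
  assumes primepow: "primepow q" and n_pos: "n > 0"
    and card_K: "card (carrier K) = q ^ n"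
    and subfield_F: "subfield F K" and card_F: "card F = q"
begin

lemma q_gt_1: "q > 1"
  using primepow_gt_Suc_0[OF primepow] by simp

lemma finite_K [simp]: "finite (carrier K)"
  using card_K q_gt_1 by (intro card_ge_0_finite) auto

lemma F_subset: "F \<subseteq> carrier K"
  using subfield_F by (rule subfieldE(3))

lemma F_in_K [simp]: "c \<in> F \<Longrightarrow> c \<in> carrier K"
  using F_subset by auto

lemmas F_subring [simp] = subringE(2,3,5,6,7)[OF subfieldE(1)[OF subfield_F]]

lemma finite_F [simp]: "finite F"
  using F_subset finite_K by (rule finite_subset)

lemma frob_zero [simp]: "\<zero> [^] (q ^ i) = \<zero>"
  using q_gt_1 by (simp add: nat_pow_zero)

lemma frob_add:
  assumes "x \<in> carrier K" "y \<in> carrier K"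
  shows "(x \<oplus> y) [^] (q ^ i) = x [^] (q ^ i) \<oplus> y [^] (q ^ i)"
proof -
  obtain p l where p: "prime p" "l > 0" "q = p ^ l"
    using primepow by (auto simp: primepow_def)
  have "card (carrier K) = p ^ (l * n)" using card_K p by (simp add: power_mult)
  then show ?thesis
    using freshmans_dream[OF _ p(1) assms, of "l * n" "l * i"] p(3) by (simp only: power_mult)
qed

lemma frob_F:
  assumes "c \<in> F"
  shows "c [^] (q ^ i) = c"
proof -
  interpret F: field "K\<lparr>carrier := F\<rparr>" using subfield_F by (rule subfield_iff(2))
  have q: "c [^] q = c"
    using F.pow_card[of c] assms card_F
    by (simp add: nat_pow_def)
  show ?thesis
    by (induction i) (use assms q in \<open>simp_all add: nat_pow_pow[symmetric]\<close>)
qed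

lemma frob_n: "x \<in> carrier K \<Longrightarrow> x [^] (q ^ n) = x"
  using pow_card[OF finite_K] card_K by simp

lemma frob_frob: "x \<in> carrier K \<Longrightarrow> (x [^] (q ^ i)) [^] (q ^ j) = x [^] (q ^ (i + j))"
  by (simp add: nat_pow_pow power_add)

lemmas frob1_add = frob_add[of _ _ 1, simplified]
lemmas frob1_F = frob_F[of _ 1, simplified]
lemmas frob1_zero [simp] = frob_zero[of 1, simplified]

section \<open>Frobenius-stable subspaces and their cardinalities\<close>

definition submod :: "'a set \<Rightarrow> bool" where
  "submod W \<longleftrightarrow> W \<subseteq> carrier K \<and> \<zero> \<in> W \<and> (\<forall>x\<in>W. \<forall>y\<in>W. x \<oplus> y \<in> W) \<and>
     (\<forall>c\<in>F. \<forall>x\<in>W. c \<otimes> x \<in> W) \<and> (\<forall>x\<in>W. x [^] q \<in> W)"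

declare Span.simps [simp del]

lemma submodD:
  assumes "submod W"
  shows "W \<subseteq> carrier K" "\<zero> \<in> W" "\<And>x y. x \<in> W \<Longrightarrow> y \<in> W \<Longrightarrow> x \<oplus> y \<in> W"
    "\<And>c x. c \<in> F \<Longrightarrow> x \<in> W \<Longrightarrow> c \<otimes> x \<in> W" "\<And>x. x \<in> W \<Longrightarrow> x [^] q \<in> W"
    "\<And>x. x \<in> W \<Longrightarrow> x \<in> carrier K"
  using assms unfolding submod_def by auto

lemma submod_uminus:
  assumes "submod W" "x \<in> W"
  shows "\<ominus> x \<in> W"
  using submodD(4)[OF assms(1), of "\<ominus> \<one>" x] submodD(6)[OF assms] assms(2) by (simp add: l_minus)

lemma submod_minus: "submod W \<Longrightarrow> x \<in> W \<Longrightarrow> y \<in> W \<Longrightarrow> x \<ominus> y \<in> W"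
  by (simp add: a_minus_def submodD(3) submod_uminus)

lemma submod_frob: "submod W \<Longrightarrow> x \<in> W \<Longrightarrow> x [^] (q ^ i) \<in> W"
proof (induction i)
  case (Suc i)
  then show ?case using submodD(5)[of W "x [^] (q ^ i)"] submodD(6)[of W x]
    by (simp add: nat_pow_pow mult.commute)
qed (simp add: submodD(6))

lemma submod_finite: "submod W \<Longrightarrow> finite W"
  using finite_K submodD(1) by (rule finite_subset[rotated])

lemma submod_subgroup: "submod W \<Longrightarrow> subgroup W (add_monoid K)"
  by (rule add.subgroupI) (auto simp: submodD submod_uminus dest: submodD(2))

lemma submod_carrier: "submod (carrier K)"
  by (auto simp: submod_def)

lemma submod_zero: "submod {\<zero>}"
  by (auto simp: submod_def)

lemma submod_Int: "submod V \<Longrightarrow> submod W \<Longrightarrow> submod (V \<inter> W)"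
  unfolding submod_def by blast

text \<open>Each step of the inductive predicate adds a vector \<open>v\<close> outside
  \<open>E\<close>, and \<open>c \<otimes> v \<oplus> e\<close> determines \<open>c\<close> and
  \<open>e\<close>, so the size is multiplied by \<open>q\<close>. The field is a variable
  \<open>F'\<close> with a separate equation to suit rule induction.\<close>

lemma dimension_card_aux: "dimension d F' W \<Longrightarrow> F' = F \<Longrightarrow> card W = q ^ d"
proof (induction rule: dimension.induct)
  case zero_dim
  then show ?case by simp
next
  case (Suc_dim v E d F')
  note Suc_dim = Suc_dim[unfolded \<open>F' = F\<close>] and [simp] = \<open>F' = F\<close>
  note E = space_subgroup_props[OF subfield_F Suc_dim(3)]
  have E': "E \<subseteq> carrier K" using E(1) .
  have "bij_betw (\<lambda>(c, e). c \<otimes> v \<oplus> e) (F \<times> E) (line_extension F v E)"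
    unfolding bij_betw_def
  proof
    show "inj_on (\<lambda>(c, e). c \<otimes> v \<oplus> e) (F \<times> E)"
    proof (rule inj_onI, clarsimp)
      fix c e c' e' assume A: "c \<in> F" "e \<in> E" "c' \<in> F" "e' \<in> E" "c \<otimes> v \<oplus> e = c' \<otimes> v \<oplus> e'"
      have [simp]: "e \<in> carrier K" "e' \<in> carrier K" "v \<in> carrier K" using A E' Suc_dim by auto
      have "(c \<ominus> c') \<otimes> v = (c \<otimes> v \<oplus> e) \<ominus> (c' \<otimes> v \<oplus> e')  \<oplus> (e' \<ominus> e)"
        using A(1,3) unfolding a_minus_def
        by (simp add: l_distr l_minus minus_add) (simp add: a_ac r_neg1 r_neg2 r_neg l_neg)
      also have "\<dots> = e' \<ominus> e" using A by (simp add: a_minus_def r_neg)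
      also have "\<dots> \<in> E" using E(3,4) A by (simp add: a_minus_def)
      finally have *: "(c \<ominus> c') \<otimes> v \<in> E" .
      have "c \<ominus> c' \<in> F" using A by (simp add: a_minus_def)
      have "c \<ominus> c' = \<zero>"
      proof (rule ccontr)
        assume "c \<ominus> c' \<noteq> \<zero>"
        with \<open>c \<ominus> c' \<in> F\<close> have inv: "c \<ominus> c' \<in> F - {\<zero>}" by simp
        have "inv (c \<ominus> c') \<otimes> ((c \<ominus> c') \<otimes> v) \<in> E"
          using E(5) * subfield_m_inv(1)[OF subfield_F inv] by simp
        then have "v \<in> E"
          using subfield_m_inv[OF subfield_F inv] inv by (simp add: m_assoc[symmetric])
        then show False using Suc_dim by simp
      qed
      then have "c = c'" using A by simp
      then show "c = c' \<and> e = e'" using A by simp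
    qed
    show "(\<lambda>(c, e). c \<otimes> v \<oplus> e) ` (F \<times> E) = line_extension F v E"
      by (auto simp: line_extension_mem_iff image_iff) blast
  qed
  then show ?case
    using bij_betw_same_card Suc_dim(4) card_F by (fastforce simp: card_cartesian_product)
qed

lemmas dimension_card = dimension_card_aux[OF _ refl]

lemma Span_dimension:
  assumes "set Us \<subseteq> carrier K"
  shows "\<exists>d. dimension d F (Span F Us)"
proof -
  obtain Vs where "independent F Vs" "Span F Vs = Span F Us"
    using filter_base[OF subfield_F assms] by metis
  then show ?thesis using dimensionI[OF subfield_F] by blast
qed

text \<open>The elements of the finite set \<open>W\<close> themselves form a spanning list, so
  \<open>W\<close> has a dimension over \<open>F\<close>.\<close>

lemma submod_card:
  assumes W: "submod W"
  shows "\<exists>d. card W = q ^ d"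
proof -
  obtain Us where Us: "set Us = W" using finite_list[OF submod_finite[OF W]] by blast
  have "set Us \<subseteq> carrier K" using Us W submodD(1) by blast
  moreover have "F <#> set Us \<subseteq> W"
    unfolding Us set_mult_def using submodD(4)[OF W] by auto
  ultimately have "Span F Us = W"
    using Span_min[OF subfield_F _ submod_subgroup[OF W]] Span_base_incl[OF subfield_F] Us
    by blast
  then show ?thesis
    using Span_dimension[of Us] dimension_card \<open>set Us \<subseteq> carrier K\<close> by metis
qed

abbreviation fspan :: "'a \<Rightarrow> 'a set" where "fspan \<equiv> frob_span q K F"

lemma frob_span_least:
  assumes "submod W" "\<alpha> \<in> W"
  shows "fspan \<alpha> \<subseteq> W"
proof
  fix x assume "x \<in> fspan \<alpha>"
  then show "x \<in> W" by induction (use assms submodD[OF assms(1)] in auto)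
qed

lemma frob_span_submod:
  assumes "\<alpha> \<in> carrier K"
  shows "submod (fspan \<alpha>)"
  unfolding submod_def
proof (intro conjI ballI)
  show sub: "fspan \<alpha> \<subseteq> carrier K" using assms submod_carrier by (intro frob_span_least)
  have "\<zero> \<otimes> \<alpha> \<in> fspan \<alpha>" by (intro frob_span_smult frob_span_base) simp
  then show "\<zero> \<in> fspan \<alpha>" using assms by simp
qed (auto intro: frob_span.intros)

text \<open>Connects the span in the definition of \<open>k_normal\<close> with the generated
  submodule. The span is Frobenius-stable because \<open>\<alpha> [^] (q ^ n) = \<alpha>\<close>
  sends the last conjugate back to the first.\<close>

lemma Span_orbit:
  assumes a [simp]: "\<alpha> \<in> carrier K"
  shows "Span F (map (\<lambda>i. \<alpha> [^] (q ^ i)) [0..<n]) = fspan \<alpha>" (is "Span F ?U = _")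
proof
  have U: "set ?U \<subseteq> carrier K" by auto
  have "F <#> set ?U \<subseteq> fspan \<alpha>"
    unfolding set_mult_def
    using submodD(4)[OF frob_span_submod[OF a]] submod_frob[OF frob_span_submod[OF a] frob_span_base] by auto
  then show "Span F ?U \<subseteq> fspan \<alpha>"
    by (rule Span_min[OF subfield_F U submod_subgroup[OF frob_span_submod[OF a]]])
  note S = Span_subgroup_props[OF subfield_F U] Span_smult_closed[OF subfield_F U]
  have in_U: "x \<in> Span F ?U" if "x \<in> set ?U" for x
    using Span_base_incl[OF subfield_F U] that by blast
  \<comment> \<open>The preimage of the span under Frobenius. It is a subgroup containing the scalar
    multiples of all conjugates, so it contains the span by minimality.\<close>
  define S' where "S' = {x \<in> carrier K. x [^] q \<in> Span F ?U}"
  have "subgroup S' (add_monoid K)"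
  proof (rule add.subgroupI)
    show "S' \<noteq> {}" using S(2) by (auto simp: S'_def intro!: exI[of _ \<zero>])
  next
    fix x assume x: "x \<in> S'"
    have "(\<ominus> x) [^] q = \<ominus> (x [^] q)"
      using x frob1_add[of "\<ominus> x" x] by (simp add: S'_def l_neg minus_equality)
    then show "\<ominus> x \<in> S'" using x S(4) by (simp add: S'_def)
  qed (auto simp: S'_def frob1_add S)
  moreover have "F <#> set ?U \<subseteq> S'"
  proof -
    have "\<alpha> [^] (q ^ Suc i) \<in> Span F ?U" if "i < n" for i
    proof (cases "Suc i < n")
      case True
      then show ?thesis by (intro in_U) (force simp del: upt_Suc)
    next
      case False
      then have "\<alpha> [^] (q ^ Suc i) = \<alpha> [^] (q ^ 0)" using that frob_n[OF a] by (metis a nat_pow_eone power_0 Suc_lessI)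
      then show ?thesis using n_pos by (intro in_U) (force simp del: upt_Suc)
    qed
    then show ?thesis
      unfolding set_mult_def S'_def
      by (auto simp: nat_pow_distrib frob1_F nat_pow_pow mult.commute intro!: S)
  qed
  ultimately have "Span F ?U \<subseteq> S'" by (intro Span_min[OF subfield_F U])
  then have "submod (Span F ?U)"
    using S unfolding submod_def S'_def by auto
  moreover have "\<alpha> \<in> Span F ?U" using n_pos by (intro in_U) (force simp: image_iff)
  ultimately show "fspan \<alpha> \<subseteq> Span F ?U" by (rule frob_span_least)
qed

lemma k_normal_iff:
  assumes a [simp]: "\<alpha> \<in> carrier K"
  shows "k_normal q n k K F \<alpha> \<longleftrightarrow> k \<le> n \<and> card (fspan \<alpha>) = q ^ (n - k)"
proof -
  obtain d where d: "dimension d F (fspan \<alpha>)"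
    using Span_dimension[of "map (\<lambda>i. \<alpha> [^] (q ^ i)) [0..<n]"] unfolding Span_orbit[OF a]
    by (auto simp: image_subset_iff)
  then have "card (fspan \<alpha>) = q ^ (n - k) \<longleftrightarrow> d = n - k"
    using dimension_card q_gt_1 by auto
  moreover have "dimension (n - k) F (fspan \<alpha>) \<longleftrightarrow> d = n - k"
    using d dimension_is_inj[OF subfield_F] by auto
  ultimately show ?thesis unfolding k_normal_def Span_orbit[OF a] by simp
qed

section \<open>Frobenius operators\<close>

definition endo :: "('a \<Rightarrow> 'a) \<Rightarrow> bool" where
  "endo f \<longleftrightarrow> (\<forall>x\<in>carrier K. f x \<in> carrier K) \<and>
     (\<forall>x\<in>carrier K. \<forall>y\<in>carrier K. f (x \<oplus> y) = f x \<oplus> f y) \<and>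
     (\<forall>c\<in>F. \<forall>x\<in>carrier K. f (c \<otimes> x) = c \<otimes> f x) \<and>
     (\<forall>x\<in>carrier K. f (x [^] q) = f x [^] q)"

lemma endoD:
  assumes "endo f"
  shows "x \<in> carrier K \<Longrightarrow> f x \<in> carrier K"
    "x \<in> carrier K \<Longrightarrow> y \<in> carrier K \<Longrightarrow> f (x \<oplus> y) = f x \<oplus> f y"
    "c \<in> F \<Longrightarrow> x \<in> carrier K \<Longrightarrow> f (c \<otimes> x) = c \<otimes> f x"
    "x \<in> carrier K \<Longrightarrow> f (x [^] q) = f x [^] q"
  using assms unfolding endo_def by auto

lemma endo_zero: "endo f \<Longrightarrow> f \<zero> = \<zero>"
  using endoD(3)[of f \<zero> \<zero>] endoD(1)[of f \<zero>] by simp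

lemma endo_uminus: "endo f \<Longrightarrow> x \<in> carrier K \<Longrightarrow> f (\<ominus> x) = \<ominus> f x"
  using endoD(3)[of f "\<ominus> \<one>" x] endoD(1)[of f x] by (simp add: l_minus)

lemma endo_minus: "endo f \<Longrightarrow> x \<in> carrier K \<Longrightarrow> y \<in> carrier K \<Longrightarrow> f (x \<ominus> y) = f x \<ominus> f y"
  by (simp add: a_minus_def endoD endo_uminus)

lemma endo_compose: "endo f \<Longrightarrow> endo g \<Longrightarrow> endo (\<lambda>x. f (g x))"
  by (simp add: endo_def)

lemma submod_vimage:
  assumes "endo f" "submod W"
  shows "submod {x \<in> carrier K. f x \<in> W}"
  using endoD[OF assms(1)] endo_zero[OF assms(1)] submodD[OF assms(2)]
  unfolding submod_def by auto

lemma submod_image: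
  assumes f: "endo f" and W: "submod W"
  shows "submod (f ` W)"
  unfolding submod_def
proof (intro conjI ballI)
  show "f ` W \<subseteq> carrier K" using endoD(1)[OF f] submodD(6)[OF W] by auto
  show "\<zero> \<in> f ` W" using endo_zero[OF f] submodD(2)[OF W] by force
  fix x assume "x \<in> f ` W"
  then obtain w where w: "w \<in> W" "x = f w" by auto
  show "x [^] q \<in> f ` W"
    using w endoD(4)[OF f, of w] submodD(5,6)[OF W, of w] by (metis image_eqI)
  { fix c assume "c \<in> F"
    then show "c \<otimes> x \<in> f ` W"
      using w endoD(3)[OF f, of c w] submodD(4)[OF W, of c w] submodD(6)[OF W] by force }
  fix y assume "y \<in> f ` W"
  then obtain v where v: "v \<in> W" "y = f v" by auto
  show "x \<oplus> y \<in> f ` W"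
    using v w endoD(2)[OF f, of w v] submodD(3)[OF W, of w v] submodD(6)[OF W] by force
qed

abbreviation ker :: "('a \<Rightarrow> 'a) \<Rightarrow> 'a set" where
  "ker f \<equiv> {x \<in> carrier K. f x = \<zero>}"

lemma submod_ker: "endo f \<Longrightarrow> submod (ker f)"
  using submod_vimage[OF _ submod_zero] by simp

text \<open>The fibre over each point of the image is a coset of the kernel. The target
  \<open>S\<close> is an arbitrary set because later it consists of the elements of a given
  defect.\<close>

lemma card_vimage_endo:
  assumes f: "endo f" and V: "submod V"
  shows "card {x \<in> V. f x \<in> S} = card (V \<inter> ker f) * card (f ` V \<inter> S)"
proof -
  have fin: "finite V" using V by (rule submod_finite)
  have "{x \<in> V. f x \<in> S} = (\<Union>y \<in> f ` V \<inter> S. {x \<in> V. f x = y})" by auto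
  then have "card {x \<in> V. f x \<in> S} = (\<Sum>y \<in> f ` V \<inter> S. card {x \<in> V. f x = y})"
    using fin by (simp only:) (rule card_UN_disjoint; auto)
  also have "\<dots> = (\<Sum>y \<in> f ` V \<inter> S. card (V \<inter> ker f))"
  proof (rule sum.cong[OF refl])
    fix y assume "y \<in> f ` V \<inter> S"
    then obtain v where v: "v \<in> V" "y = f v" by auto
    note [simp] = submodD(6)[OF V] endoD(1,2)[OF f] endo_minus[OF f]
    have "bij_betw (\<lambda>x. x \<oplus> v) (V \<inter> ker f) {x \<in> V. f x = y}"
    proof (rule bij_betw_byWitness[where f' = "\<lambda>x. x \<ominus> v"])
      show "\<forall>x\<in>V \<inter> ker f. x \<oplus> v \<ominus> v = x" using v by (auto simp: a_minus_def a_assoc r_neg)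
      show "\<forall>x\<in>{x \<in> V. f x = y}. x \<ominus> v \<oplus> v = x" using v by (auto simp: a_minus_def a_assoc l_neg)
      show "(\<lambda>x. x \<oplus> v) ` (V \<inter> ker f) \<subseteq> {x \<in> V. f x = y}"
        using v submodD(3)[OF V] by auto
      show "(\<lambda>x. x \<ominus> v) ` {x \<in> V. f x = y} \<subseteq> V \<inter> ker f"
        using v submod_minus[OF V] by auto
    qed
    then show "card {x \<in> V. f x = y} = card (V \<inter> ker f)"
      by (simp add: bij_betw_same_card)
  qed
  finally show ?thesis by (simp add: mult.commute)
qed

lemma card_ker_image:
  assumes f: "endo f" and V: "submod V"
  shows "card V = card (V \<inter> ker f) * card (f ` V)"
  using card_vimage_endo[OF assms, of UNIV] by simp

section \<open>Linearised polynomials\<close>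

text \<open>With \<open>c_i\<close> the entries of \<open>cs\<close> from the head, this is the sum
  of \<open>c_i \<otimes> x [^] (q ^ i)\<close>, a polynomial in Frobenius applied to
  \<open>x\<close>.\<close>

primrec frob_op :: "'a list \<Rightarrow> 'a \<Rightarrow> 'a" where
  "frob_op [] x = \<zero>"
| "frob_op (c # cs) x = c \<otimes> x \<oplus> frob_op cs (x [^] q)"

lemma frob_op_closed: "set cs \<subseteq> F \<Longrightarrow> x \<in> carrier K \<Longrightarrow> frob_op cs x \<in> carrier K"
  by (induction cs arbitrary: x) auto

lemma frob_op_in_submod: "set cs \<subseteq> F \<Longrightarrow> submod W \<Longrightarrow> x \<in> W \<Longrightarrow> frob_op cs x \<in> W"
  by (induction cs arbitrary: x) (auto simp: submodD)

lemma endo_frob_op_commute: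
  assumes "endo f" "set cs \<subseteq> F" "x \<in> carrier K"
  shows "f (frob_op cs x) = frob_op cs (f x)"
  using assms(2,3)
  by (induction cs arbitrary: x) (simp_all add: endo_zero endoD frob_op_closed assms(1))

lemma frob_op_add:
  assumes "set cs \<subseteq> F" "x \<in> carrier K" "y \<in> carrier K"
  shows "frob_op cs (x \<oplus> y) = frob_op cs x \<oplus> frob_op cs y"
  using assms
proof (induction cs arbitrary: x y)
  case (Cons c cs)
  have "frob_op cs ((x \<oplus> y) [^] q) = frob_op cs (x [^] q) \<oplus> frob_op cs (y [^] q)"
    using Cons by (simp add: frob1_add)
  then show ?case using Cons.prems by (simp add: r_distr a_ac frob_op_closed)
qed simp

lemma frob_op_smult:
  assumes "set cs \<subseteq> F" "c \<in> F" "x \<in> carrier K"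
  shows "frob_op cs (c \<otimes> x) = c \<otimes> frob_op cs x"
  using assms
proof (induction cs arbitrary: x)
  case (Cons d cs)
  have "frob_op cs ((c \<otimes> x) [^] q) = c \<otimes> frob_op cs (x [^] q)"
    using Cons by (simp add: nat_pow_distrib frob1_F)
  then show ?case using Cons.prems by (simp add: r_distr m_lcomm frob_op_closed)
qed simp

lemma frob_op_frob:
  assumes "set cs \<subseteq> F" "x \<in> carrier K"
  shows "frob_op cs (x [^] q) = frob_op cs x [^] q"
  using assms
proof (induction cs arbitrary: x)
  case (Cons c cs)
  have "(c \<otimes> x \<oplus> frob_op cs (x [^] q)) [^] q = c \<otimes> x [^] q \<oplus> frob_op cs (x [^] q) [^] q"
    using Cons.prems by (simp add: frob1_add nat_pow_distrib frob1_F frob_op_closed)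
  then show ?case using Cons by simp
qed simp

lemma endo_frob_op: "set cs \<subseteq> F \<Longrightarrow> endo (frob_op cs)"
  unfolding endo_def by (auto simp: frob_op_closed frob_op_add frob_op_smult frob_op_frob)

text \<open>As an ordinary polynomial the operator has its coefficients at powers of
  \<open>q\<close>. The shift \<open>i\<close> serves the induction, since the tail of the list acts
  on the next Frobenius power.\<close>

lemma frob_op_as_UP:
  assumes "set cs \<subseteq> F"
  shows "\<exists>f \<in> carrier (UP K).
     (\<forall>j<length cs. UnivPoly.coeff (UP K) f (q ^ (i + j)) = cs ! j) \<and>
     (\<forall>m. m \<notin> (\<lambda>j. q ^ (i + j)) ` {..<length cs} \<longrightarrow> UnivPoly.coeff (UP K) f m = \<zero>) \<and>
     (\<forall>x \<in> carrier K. eval K K id x f = frob_op cs (x [^] (q ^ i)))"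
  using assms
proof (induction cs arbitrary: i)
  case Nil
  interpret U: UP_domain K "UP K" by unfold_locales simp
  have "eval K K id b \<zero>\<^bsub>UP K\<^esub> = \<zero>" if "b \<in> carrier K" for b
    using U.evalRR_monom[OF zero_closed that, of 0] that by simp
  then show ?case by (intro bexI[of _ "\<zero>\<^bsub>UP K\<^esub>"]) (auto simp: id_def)
next
  case (Cons c cs)
  interpret U: UP_domain K "UP K" by unfold_locales simp
  have c: "c \<in> carrier K" using Cons.prems by auto
  have "set cs \<subseteq> F" using Cons.prems by simp
  from Cons.IH[OF this, of "Suc i"] obtain f where f1: "f \<in> carrier (UP K)" and
    f2: "(\<forall>j<length cs. UnivPoly.coeff (UP K) f (q ^ (Suc i + j)) = cs ! j) \<and>
     (\<forall>m. m \<notin> (\<lambda>j. q ^ (Suc i + j)) ` {..<length cs} \<longrightarrow> UnivPoly.coeff (UP K) f m = \<zero>) \<and>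
     (\<forall>x \<in> carrier K. eval K K id x f = frob_op cs (x [^] (q ^ Suc i)))"
    by (rule bexE)
  note f = f1 f2[THEN conjunct1, rule_format] f2[THEN conjunct2, THEN conjunct1, rule_format]
    f2[THEN conjunct2, THEN conjunct2, rule_format]
  define h where "h = UnivPoly.monom (UP K) c (q ^ i) \<oplus>\<^bsub>UP K\<^esub> f"
  have h: "h \<in> carrier (UP K)" using f c by (simp add: h_def)
  have coeff: "UnivPoly.coeff (UP K) h m = (if q ^ i = m then c else \<zero>) \<oplus> UnivPoly.coeff (UP K) f m" for m
    using f c by (simp add: h_def)
  have inj: "q ^ a = q ^ b \<longleftrightarrow> a = b" for a b using q_gt_1 by simp
  have fi: "UnivPoly.coeff (UP K) f (q ^ i) = \<zero>"
    by (rule f(3)) (auto simp: inj simp del: power_Suc)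
  have A: "UnivPoly.coeff (UP K) h (q ^ (i + j)) = (c # cs) ! j" if "j < length (c # cs)" for j
  proof (cases j)
    case 0
    then show ?thesis using fi c by (simp add: coeff)
  next
    case (Suc j')
    then have "j' < length cs" "cs ! j' \<in> F" using that Cons.prems by (auto dest: nth_mem)
    then show ?thesis using f(2)[of j'] Suc c by (auto simp: coeff inj simp del: power_Suc)
  qed
  have B: "UnivPoly.coeff (UP K) h m = \<zero>"
    if m: "m \<notin> (\<lambda>j. q ^ (i + j)) ` {..<length (c # cs)}" for m
  proof -
    have "m \<noteq> q ^ i"
    proof
      assume "m = q ^ i"
      then have "m \<in> (\<lambda>j. q ^ (i + j)) ` {..<length (c # cs)}"
        by (intro image_eqI[of _ _ 0]) simp_all
      then show False using m by contradiction
    qed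
    moreover have "m \<notin> (\<lambda>j. q ^ (Suc i + j)) ` {..<length cs}"
    proof
      assume "m \<in> (\<lambda>j. q ^ (Suc i + j)) ` {..<length cs}"
      then obtain j where "j < length cs" "m = q ^ (Suc i + j)" by blast
      then have "m \<in> (\<lambda>j. q ^ (i + j)) ` {..<length (c # cs)}"
        by (intro image_eqI[of _ _ "Suc j"]) simp_all
      then show False using m by contradiction
    qed
    ultimately show ?thesis using f(3)[of m] by (simp add: coeff)
  qed
  have C: "eval K K id x h = frob_op (c # cs) (x [^] (q ^ i))" if x: "x \<in> carrier K" for x
    using x c f(1) f(4)[OF x] unfolding h_def
    by (simp add: U.evalRR_simps nat_pow_pow mult.commute)
  show ?case
    by (rule bexI[OF _ h], intro conjI allI impI ballI) (rule A, assumption, rule B, assumption, rule C)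
qed

text \<open>The operator is an ordinary nonzero polynomial of degree at most \<open>q ^ r\<close>,
  and its kernel is its set of roots.\<close>

lemma frob_op_ker_card_le:
  assumes cs: "set cs \<subseteq> F" and "\<not> set cs \<subseteq> {\<zero>}" and len: "length cs \<le> Suc r"
  shows "card (ker (frob_op cs)) \<le> q ^ r"
proof -
  obtain j where j: "j < length cs" "cs ! j \<noteq> \<zero>" using assms(2) by (metis in_set_conv_nth singletonI subsetI)
  obtain f where f: "f \<in> carrier (UP K)"
    "\<forall>j<length cs. UnivPoly.coeff (UP K) f (q ^ j) = cs ! j"
    "\<And>m. m \<notin> (\<lambda>j. q ^ j) ` {..<length cs} \<Longrightarrow> UnivPoly.coeff (UP K) f m = \<zero>"
    "\<And>x. x \<in> carrier K \<Longrightarrow> eval K K id x f = frob_op cs x"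
    using frob_op_as_UP[OF cs, of 0] by auto
  have "ker (frob_op cs) = {x \<in> carrier K. eval K K id x f = \<zero>}" using f(4) by auto
  also have "card \<dots> \<le> q ^ r"
  proof (rule finite_roots_card_le[OF finite_K f(1), of "q ^ j"])
    show "UnivPoly.coeff (UP K) f (q ^ j) \<noteq> \<zero>" using f(2) j by simp
    fix m assume "q ^ r < m"
    then have "m \<notin> (\<lambda>j. q ^ j) ` {..<length cs}" using q_gt_1 len by auto
    then show "UnivPoly.coeff (UP K) f m = \<zero>" by (rule f(3))
  qed
  finally show ?thesis .
qed

text \<open>Pigeonhole on the tuples of coefficients yields an annihilating operator; its kernel
  cannot be larger than \<open>fspan \<alpha>\<close> by the bound on the number of roots.\<close>
lemma frob_span_eq_ker:
  assumes a: "\<alpha> \<in> carrier K"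
  obtains cs where "set cs \<subseteq> F" "ker (frob_op cs) = fspan \<alpha>"
proof -
  note sub = frob_span_submod[OF a]
  obtain r where r: "card (fspan \<alpha>) = q ^ r" using submod_card[OF sub] by blast
  let ?L = "{cs. set cs \<subseteq> F \<and> length cs = Suc r}"
  have "card ?L = q ^ Suc r" using card_lists_length_eq[of F "Suc r"] card_F by simp
  moreover have "(\<lambda>cs. frob_op cs \<alpha>) ` ?L \<subseteq> fspan \<alpha>"
    using frob_op_in_submod[OF _ sub frob_span_base] by auto
  then have "card ((\<lambda>cs. frob_op cs \<alpha>) ` ?L) \<le> q ^ r"
    using card_mono[OF submod_finite[OF sub]] r by metis
  ultimately have "\<not> inj_on (\<lambda>cs. frob_op cs \<alpha>) ?L"
    using q_gt_1 by (auto simp: card_image)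
  then obtain cs ds where *: "set cs \<subseteq> F" "length cs = Suc r" "set ds \<subseteq> F" "length ds = Suc r"
    "cs \<noteq> ds" "frob_op cs \<alpha> = frob_op ds \<alpha>"
    unfolding inj_on_def by auto
  \<comment> \<open>The difference of two distinct tuples with the same value at \<alpha> is a
    nonzero operator that kills \<alpha>.\<close>
  define es where "es = map2 (\<lambda>c d. c \<ominus> d) cs ds"
  have len: "length cs = length ds" using * by simp
  have es_F: "set es \<subseteq> F"
    using len *(1,3) unfolding es_def by (induction cs ds rule: list_induct2) (auto simp: a_minus_def)
  have "frob_op es x = frob_op cs x \<ominus> frob_op ds x" if "x \<in> carrier K" for x
    using len *(1,3) that unfolding es_def
  proof (induction cs ds arbitrary: x rule: list_induct2)
    case (Cons c cs d ds)
    have "frob_op (map2 (\<lambda>c d. c \<ominus> d) cs ds) (x [^] q) = frob_op cs (x [^] q) \<ominus> frob_op ds (x [^] q)"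
      using Cons by simp
    then show ?case using Cons.prems
      by (simp add: a_minus_def l_distr l_minus frob_op_closed minus_add a_ac)
  qed (simp add: a_minus_def)
  then have zero: "frob_op es \<alpha> = \<zero>" using * a by (simp add: frob_op_closed)
  have "\<not> set es \<subseteq> {\<zero>}"
  proof
    assume z: "set es \<subseteq> {\<zero>}"
    have "cs = ds" using len *(1,3) z unfolding es_def
      by (induction cs ds rule: list_induct2) auto
    then show False using * by simp
  qed
  moreover have "length es \<le> Suc r" using * by (simp add: es_def)
  ultimately have le: "card (ker (frob_op es)) \<le> card (fspan \<alpha>)"
    unfolding r using es_F by (intro frob_op_ker_card_le)
  have "fspan \<alpha> \<subseteq> ker (frob_op es)"
    using zero a by (intro frob_span_least submod_ker endo_frob_op es_F) simp
  then have "fspan \<alpha> = ker (frob_op es)"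
    using le by (intro card_seteq) auto
  then show ?thesis using that es_F by metis
qed

section \<open>Simple submodules as kernels of operators\<close>

definition simple :: "'a set \<Rightarrow> bool" where
  "simple W \<longleftrightarrow> submod W \<and> W \<noteq> {\<zero>} \<and> (\<forall>V. submod V \<longrightarrow> V \<subseteq> W \<longrightarrow> V = {\<zero>} \<or> V = W)"

lemma simple_submod: "simple W \<Longrightarrow> submod W"
  by (simp add: simple_def)

lemma simple_nonzero:
  assumes "simple W"
  obtains w where "w \<in> W" "w \<noteq> \<zero>"
  using assms submodD(2) unfolding simple_def by blast

lemma simple_frob_span:
  assumes "simple W" "w \<in> W" "w \<noteq> \<zero>"
  shows "fspan w = W"
proof -
  have "submod (fspan w)" "fspan w \<subseteq> W"
    using assms submodD(6)[OF simple_submod] frob_span_submod frob_span_least[OF simple_submod] by auto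
  moreover have "fspan w \<noteq> {\<zero>}" using frob_span_base[of w] assms(3) by auto
  ultimately show ?thesis using assms(1) unfolding simple_def by blast
qed

lemma simple_eq_ker:
  assumes "simple W"
  obtains cs where "set cs \<subseteq> F" "ker (frob_op cs) = W"
proof -
  obtain w where w: "w \<in> W" "w \<noteq> \<zero>" using simple_nonzero[OF assms] by blast
  then have "w \<in> carrier K" using submodD(6)[OF simple_submod[OF assms]] by blast
  then obtain cs where "set cs \<subseteq> F" "ker (frob_op cs) = fspan w" by (rule frob_span_eq_ker)
  then show ?thesis using that simple_frob_span[OF assms w] by simp
qed

lemma simple_exists:
  assumes "submod V" "V \<noteq> {\<zero>}"
  obtains W where "simple W" "W \<subseteq> V"
proof -
  define P where "P W \<longleftrightarrow> submod W \<and> W \<noteq> {\<zero>} \<and> W \<subseteq> V" for W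
  obtain W where W: "P W" "\<And>W'. P W' \<Longrightarrow> card W \<le> card W'"
    using ex_has_least_nat[of P V card] assms unfolding P_def by blast
  have "simple W" unfolding simple_def
  proof (intro conjI allI impI)
    show "submod W" "W \<noteq> {\<zero>}" using W by (auto simp: P_def)
    fix V' assume "submod V'" "V' \<subseteq> W"
    show "V' = {\<zero>} \<or> V' = W"
    proof (rule disjCI)
      assume "V' \<noteq> W"
      then have "card V' < card W" using \<open>V' \<subseteq> W\<close> submod_finite[of W] W
        by (intro psubset_card_mono) (auto simp: P_def)
      then have "\<not> P V'" using W(2) by fastforce
      then show "V' = {\<zero>}" using \<open>submod V'\<close> \<open>V' \<subseteq> W\<close> W(1) unfolding P_def by blast
    qed
  qed
  then show ?thesis using that W(1) unfolding P_def by blast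
qed

text \<open>Both \<open>card (ker (h \<circ> P))\<close> and \<open>card (ker (P \<circ> h))\<close> can be computed, where \<open>h\<close> and \<open>P\<close> are
  the operators with kernels \<open>fspan \<alpha>\<close> and \<open>W\<close>, with \<open>W \<subseteq> h ` U\<close>.\<close>
lemma not_generating_in_image:
  assumes a: "\<alpha> \<in> carrier K" and U: "submod U" and "\<not> U \<subseteq> fspan \<alpha>"
    and sel: "\<And>W. simple W \<Longrightarrow> set (sel W) \<subseteq> F" "\<And>W. simple W \<Longrightarrow> ker (frob_op (sel W)) = W"
  obtains W where "simple W" "W \<subseteq> U" "\<alpha> \<in> frob_op (sel W) ` carrier K"
proof -
  obtain hs where hs: "set hs \<subseteq> F" "ker (frob_op hs) = fspan \<alpha>" using frob_span_eq_ker[OF a] by blast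
  note h = endo_frob_op[OF hs(1)]
  note UK = submodD(1)[OF U]
  have hU: "submod (frob_op hs ` U)" using h U by (rule submod_image)
  \<comment> \<open>\<open>U\<close> is not contained in \<open>fspan \<alpha>\<close>, which is the
    kernel of \<open>frob_op hs\<close>.\<close>
  moreover have "frob_op hs ` U \<noteq> {\<zero>}" using assms(3) hs(2) UK by blast
  ultimately obtain W where W: "simple W" "W \<subseteq> frob_op hs ` U" using simple_exists by metis
  have WU: "W \<subseteq> U" using W frob_op_in_submod[OF hs(1) U] by blast
  define ps where "ps = sel W"
  have ps: "set ps \<subseteq> F" "ker (frob_op ps) = W" using sel[OF W(1)] by (simp_all add: ps_def)
  note P = endo_frob_op[OF ps(1)]
  let ?V = "carrier K"
  have comm: "frob_op hs (frob_op ps x) = frob_op ps (frob_op hs x)" if "x \<in> ?V" for x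
    using endo_frob_op_commute[OF h ps(1) that] .
  \<comment> \<open>The operators commute, and \<open>W\<close> and \<open>fspan \<alpha>\<close>
    are their kernels, so both sides are the kernel of the composition.\<close>
  have "{x \<in> ?V. frob_op hs x \<in> W} = {x \<in> ?V. frob_op ps x \<in> fspan \<alpha>}"
    using comm ps(2)[symmetric] hs(2)[symmetric] endoD(1)[OF h] endoD(1)[OF P] by auto
  moreover have "card {x \<in> ?V. frob_op hs x \<in> W} = card (fspan \<alpha>) * card W"
  proof -
    have "frob_op hs ` ?V \<inter> W = W" using W UK by blast
    moreover have "?V \<inter> ker (frob_op hs) = fspan \<alpha>" using hs(2) by auto
    ultimately show ?thesis using card_vimage_endo[OF h submod_carrier, of W] by simp
  qed
  moreover have "card {x \<in> ?V. frob_op ps x \<in> fspan \<alpha>} = card W * card (frob_op ps ` ?V \<inter> fspan \<alpha>)"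
  proof -
    have "?V \<inter> ker (frob_op ps) = W" using ps(2) by auto
    then show ?thesis using card_vimage_endo[OF P submod_carrier, of "fspan \<alpha>"] by simp
  qed
  moreover have "card W > 0" using submod_finite[OF simple_submod[OF W(1)]] submodD(2)[OF simple_submod[OF W(1)]]
    by (auto simp: card_gt_0_iff)
  \<comment> \<open>Cancelling \<open>card W\<close> in the two counts shows that the image of
    \<open>frob_op ps\<close> meets \<open>fspan \<alpha>\<close> in a set of full size.\<close>
  ultimately have "card (frob_op ps ` ?V \<inter> fspan \<alpha>) = card (fspan \<alpha>)" by simp
  then have "frob_op ps ` ?V \<inter> fspan \<alpha> = fspan \<alpha>"
    using submod_finite[OF frob_span_submod[OF a]] by (intro card_subset_eq) auto
  then have "\<alpha> \<in> frob_op ps ` ?V" using frob_span_base[of \<alpha> q K F] by blast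
  then show ?thesis using that W(1) WU unfolding ps_def by blast
qed

lemma card_image_frob_op:
  assumes "set ps \<subseteq> F" "ker (frob_op ps) = W"
  shows "card W * card (frob_op ps ` carrier K) = q ^ n"
proof -
  have "carrier K \<inter> ker (frob_op ps) = W" using assms(2) by blast
  then show ?thesis using card_ker_image[OF endo_frob_op[OF assms(1)] submod_carrier] card_K by simp
qed

section \<open>Simple submodules\<close>

text \<open>For \<open>e\<close> dividing \<open>n\<close> this is the intermediate field with
  \<open>q ^ e\<close> elements.\<close>

definition fixed_pts :: "nat \<Rightarrow> 'a set" where
  "fixed_pts e = {x \<in> carrier K. x [^] (q ^ e) = x}"

lemma fixed_ptsD: "x \<in> fixed_pts e \<Longrightarrow> x \<in> carrier K" "x \<in> fixed_pts e \<Longrightarrow> x [^] (q ^ e) = x"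
  by (auto simp: fixed_pts_def)

lemma submod_fixed_pts: "submod (fixed_pts e)"
proof -
  have "(x [^] q) [^] (q ^ e) = (x [^] (q ^ e)) [^] q" if "x \<in> carrier K" for x
    using that by (simp add: nat_pow_pow mult.commute)
  then show ?thesis unfolding submod_def fixed_pts_def
    by (auto simp: frob_add frob_F nat_pow_distrib)
qed

lemma fixed_pts_mult: "x \<in> fixed_pts e \<Longrightarrow> x \<in> fixed_pts (e * m)"
proof (induction m)
  case (Suc m)
  then have "x \<in> carrier K" by (simp add: fixed_ptsD)
  then have "x [^] (q ^ (e + e * m)) = x"
    using Suc fixed_ptsD(2)[of x] by (simp flip: frob_frob)
  then show ?case using \<open>x \<in> carrier K\<close> by (simp add: fixed_pts_def)
qed (simp add: fixed_pts_def)

lemma fixed_pts_dvd: "e dvd m \<Longrightarrow> fixed_pts e \<subseteq> fixed_pts m"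
  using fixed_pts_mult by (auto simp: dvd_def)

lemma fixed_pts_mod:
  assumes "x \<in> fixed_pts e" "x \<in> fixed_pts m"
  shows "x \<in> fixed_pts (m mod e)"
proof -
  note x = fixed_ptsD(1)[OF assms(1)]
  have "x [^] (q ^ (m mod e)) = (x [^] (q ^ (e * (m div e)))) [^] (q ^ (m mod e))"
    using fixed_ptsD(2)[OF fixed_pts_mult[OF assms(1)]] by simp
  also have "\<dots> = x" using fixed_ptsD(2)[OF assms(2)] by (simp add: frob_frob[OF x])
  finally show ?thesis using x by (simp add: fixed_pts_def)
qed

lemma fixed_pts_n: "fixed_pts n = carrier K"
  using frob_n by (auto simp: fixed_pts_def)

lemma frob_op_replicate:
  "x \<in> carrier K \<Longrightarrow> set cs \<subseteq> F \<Longrightarrow> frob_op (replicate k \<zero> @ cs) x = frob_op cs (x [^] (q ^ k))"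
  by (induction k arbitrary: x) (simp_all add: nat_pow_pow frob_op_closed)

lemma fixed_pts_card_le:
  assumes "e > 0"
  shows "card (fixed_pts e) \<le> q ^ e"
proof -
  \<comment> \<open>The coefficients of \<open>X^e - 1\<close>, with \<open>e - 1\<close> zeros
    between the two ends; the fixed points become the kernel of this operator.\<close>
  define cs where "cs = (\<ominus> \<one>) # replicate (e - 1) \<zero> @ [\<one>]"
  have F: "set cs \<subseteq> F" by (auto simp: cs_def)
  have "frob_op cs x = \<ominus> x \<oplus> x [^] (q ^ e)" if "x \<in> carrier K" for x
  proof -
    have "q * q ^ (e - 1) = q ^ e" using assms by (cases e) auto
    then show ?thesis using that by (simp add: cs_def frob_op_replicate l_minus nat_pow_pow)
  qed
  then have "frob_op cs x = \<zero> \<longleftrightarrow> x [^] (q ^ e) = x" if "x \<in> carrier K" for x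
    using that by (metis a_minus_def a_comm add.inv_closed nat_pow_closed r_right_minus_eq)
  then have "fixed_pts e = ker (frob_op cs)" unfolding fixed_pts_def by blast
  also have "card \<dots> \<le> q ^ e"
    using F assms by (intro frob_op_ker_card_le) (auto simp: cs_def)
  finally show ?thesis .
qed

section \<open>Independence and number of simple submodules\<close>

lemma submod_sum:
  assumes "submod V" "submod W"
  shows "submod ((\<lambda>(x, y). x \<oplus> y) ` (V \<times> W))"
  unfolding submod_def
proof (intro conjI ballI)
  note [simp] = submodD(6)[OF assms(1)] submodD(6)[OF assms(2)]
  let ?S = "(\<lambda>(x, y). x \<oplus> y) ` (V \<times> W)"
  show "?S \<subseteq> carrier K" by auto
  show "\<zero> \<in> ?S" using submodD(2)[OF assms(1)] submodD(2)[OF assms(2)]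
    by (intro image_eqI[of _ _ "(\<zero>, \<zero>)"]) auto
  fix z assume "z \<in> ?S"
  then obtain x y where z: "x \<in> V" "y \<in> W" "z = x \<oplus> y" by auto
  show "z [^] q \<in> ?S" using z submodD(5)[OF assms(1)] submodD(5)[OF assms(2)]
    by (intro image_eqI[of _ _ "(x [^] q, y [^] q)"]) (auto simp: frob1_add)
  { fix c assume "c \<in> F"
    then show "c \<otimes> z \<in> ?S" using z submodD(4)[OF assms(1)] submodD(4)[OF assms(2)]
      by (intro image_eqI[of _ _ "(c \<otimes> x, c \<otimes> y)"]) (auto simp: r_distr) }
  fix z' assume "z' \<in> ?S"
  then obtain x' y' where z': "x' \<in> V" "y' \<in> W" "z' = x' \<oplus> y'" by auto
  show "z \<oplus> z' \<in> ?S" using z z' submodD(3)[OF assms(1)] submodD(3)[OF assms(2)]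
    by (intro image_eqI[of _ _ "(x \<oplus> x', y \<oplus> y')"]) (auto simp: a_ac)
qed

lemma card_submod_sum:
  assumes "submod V" "submod W" "V \<inter> W = {\<zero>}"
  shows "card ((\<lambda>(x, y). x \<oplus> y) ` (V \<times> W)) = card V * card W"
proof -
  note [simp] = submodD(6)[OF assms(1)] submodD(6)[OF assms(2)]
  have "inj_on (\<lambda>(x, y). x \<oplus> y) (V \<times> W)"
  proof (rule inj_onI, clarsimp)
    fix x y x' y' assume A: "x \<in> V" "y \<in> W" "x' \<in> V" "y' \<in> W" "x \<oplus> y = x' \<oplus> y'"
    have "(x \<ominus> x') \<ominus> (y' \<ominus> y) = (x \<oplus> y) \<ominus> (x' \<oplus> y')"
      using A(1-4) by (simp add: a_minus_def minus_add a_ac)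
    also have "\<dots> = \<zero>" unfolding A(5) using A(1-4) by simp
    finally have eq: "x \<ominus> x' = y' \<ominus> y" using A(1-4) by simp
    moreover have "x \<ominus> x' \<in> V" "y' \<ominus> y \<in> W" using A assms by (simp_all add: submod_minus)
    ultimately have "x \<ominus> x' = \<zero>" using assms(3) by auto
    then show "x = x' \<and> y = y'" using eq A by simp
  qed
  then show ?thesis by (simp add: card_image card_cartesian_product)
qed

lemma simple_card_ge:
  assumes "simple W"
  obtains r where "r > 0" "card W = q ^ r"
proof -
  obtain r where r: "card W = q ^ r" using submod_card[OF simple_submod[OF assms]] by blast
  have "r \<noteq> 0"
  proof
    assume "r = 0"
    then have "card W = 1" using r by simp
    then obtain x where "W = {x}" by (auto simp: card_1_singleton_iff)
    then show False using simple_nonzero[OF assms] submodD(2)[OF simple_submod[OF assms]] by auto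
  qed
  then show ?thesis using that r by blast
qed

lemma simple_Int:
  assumes "simple V" "simple W" "V \<noteq> W"
  shows "V \<inter> W = {\<zero>}"
proof -
  have "submod (V \<inter> W)" using assms by (intro submod_Int simple_submod)
  then show ?thesis using assms unfolding simple_def by (metis inf_le1 inf_le2)
qed

text \<open>Distinct simple submodules are independent: the product \<open>Q\<close> of their annihilating operators
  kills their sum but is injective on every other simple submodule.\<close>
lemma simple_independent:
  assumes "finite S" "\<And>W. W \<in> S \<Longrightarrow> simple W" "\<And>W. W \<in> S \<Longrightarrow> W \<subseteq> V" "submod V"
  shows "\<exists>N Q. submod N \<and> N \<subseteq> V \<and> q ^ card S \<le> card N \<and> endo Q \<and>
     (\<forall>W. submod W \<longrightarrow> (\<forall>x\<in>W. Q x \<in> W)) \<and> (\<forall>x\<in>N. Q x = \<zero>) \<and>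
     (\<forall>W. simple W \<longrightarrow> W \<notin> S \<longrightarrow> (\<forall>w\<in>W. Q w = \<zero> \<longrightarrow> w = \<zero>))"
  using assms
proof (induction S rule: finite_induct)
  case empty
  show ?case
    by (rule exI[of _ "{\<zero>}"], rule exI[of _ "\<lambda>x. x"])
      (use empty in \<open>auto simp: submod_zero submodD endo_def\<close>)
next
  case (insert W0 S)
  have W0: "simple W0" "W0 \<subseteq> V" using insert.prems by auto
  obtain N Q where N: "submod N" "N \<subseteq> V" "q ^ card S \<le> card N" "endo Q"
    and Qpres: "\<And>W x. submod W \<Longrightarrow> x \<in> W \<Longrightarrow> Q x \<in> W"
    and QN: "\<And>x. x \<in> N \<Longrightarrow> Q x = \<zero>"
    and Qinj: "\<And>W w. simple W \<Longrightarrow> W \<notin> S \<Longrightarrow> w \<in> W \<Longrightarrow> Q w = \<zero> \<Longrightarrow> w = \<zero>"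
    using insert.IH insert.prems by auto
  obtain ps where ps: "set ps \<subseteq> F" "ker (frob_op ps) = W0" using simple_eq_ker[OF W0(1)] by blast
  note P = endo_frob_op[OF ps(1)]
  note sW0 = simple_submod[OF W0(1)]
  define N' where "N' = (\<lambda>(x, y). x \<oplus> y) ` (N \<times> W0)"
  have "submod N'" unfolding N'_def using N(1) sW0 by (rule submod_sum)
  moreover have "N' \<subseteq> V" unfolding N'_def using N(2) W0(2) submodD(3)[OF insert.prems(3)] by auto
  moreover have "q ^ card (insert W0 S) \<le> card N'"
  proof -
    \<comment> \<open>\<open>Q\<close> vanishes on \<open>N\<close> but is injective on
      \<open>W0\<close>, because \<open>W0\<close> is not in \<open>S\<close>; so the sum is
      direct.\<close>
    have "N \<inter> W0 = {\<zero>}"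
      using QN Qinj[OF W0(1) insert.hyps(2)] submodD(2)[OF N(1)] submodD(2)[OF sW0] by auto
    then have "card N' = card N * card W0" unfolding N'_def by (rule card_submod_sum[OF N(1) sW0])
    moreover obtain r where "r > 0" "card W0 = q ^ r" using simple_card_ge[OF W0(1)] .
    then have "q \<le> card W0" using q_gt_1 by (simp add: self_le_power)
    ultimately show ?thesis
      using insert.hyps mult_le_mono[OF \<open>q \<le> card W0\<close> N(3)] by (simp add: mult.commute)
  qed
  moreover have "endo (\<lambda>x. frob_op ps (Q x))" using P N(4) by (rule endo_compose)
  moreover have "frob_op ps (Q x) \<in> W" if "submod W" "x \<in> W" for W x
    using Qpres[OF that] frob_op_in_submod[OF ps(1) that(1)] by blast
  moreover have "frob_op ps (Q x) = \<zero>" if x: "x \<in> N'" for x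
  proof -
    obtain y w where yw: "y \<in> N" "w \<in> W0" "x = y \<oplus> w" using x unfolding N'_def by auto
    then have "Q x = Q w"
      using QN[of y] endoD(1,2)[OF N(4)] submodD(6)[OF N(1)] submodD(6)[OF sW0] by simp
    then show ?thesis using Qpres[OF sW0 yw(2)] ps(2) by auto
  qed
  moreover have "w = \<zero>" if "simple W" "W \<notin> insert W0 S" "w \<in> W" "frob_op ps (Q w) = \<zero>" for W w
  proof -
    have QW: "Q w \<in> W" using Qpres[OF simple_submod[OF that(1)] that(3)] .
    then have "Q w \<in> W0" using that(4) ps(2) submodD(6)[OF simple_submod[OF that(1)]] by auto
    then have "Q w = \<zero>" using QW simple_Int[OF that(1) W0(1)] that(2) by auto
    then show ?thesis using Qinj that by blast
  qed
  ultimately show ?case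
    by (intro exI[of _ N'] exI[of _ "\<lambda>x. frob_op ps (Q x)"]) simp
qed

text \<open>The sum of the members of \<open>S\<close> is direct and each has at least
  \<open>q\<close> elements, so \<open>fixed_pts e\<close> has at least \<open>q ^ card S\<close>
  elements, but at most \<open>q ^ e\<close>.\<close>

lemma card_simple_le:
  assumes e: "e > 0" and S: "\<And>W. W \<in> S \<Longrightarrow> simple W \<and> W \<subseteq> fixed_pts e"
  shows "finite S" "card S \<le> e"
proof -
  have "S \<subseteq> Pow (carrier K)" using S submodD(1)[OF simple_submod] by blast
  then show fin: "finite S" using finite_K by (meson finite_Pow_iff finite_subset)
  obtain N where N: "N \<subseteq> fixed_pts e" "q ^ card S \<le> card N"
    using simple_independent[OF fin _ _ submod_fixed_pts[of e]] S by blast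
  have "q ^ card S \<le> q ^ e"
    using N card_mono[OF submod_finite[OF submod_fixed_pts] N(1)] fixed_pts_card_le[OF e] by linarith
  then show "card S \<le> e" using q_gt_1 by simp
qed

section \<open>The order of Frobenius on a simple submodule\<close>

definition period :: "'a set \<Rightarrow> nat" where
  "period W = (LEAST e. e > 0 \<and> W \<subseteq> fixed_pts e)"

lemma period:
  assumes "W \<subseteq> carrier K"
  shows "period W > 0" "W \<subseteq> fixed_pts (period W)"
    and "\<And>m. W \<subseteq> fixed_pts m \<longleftrightarrow> period W dvd m"
proof -
  have "n > 0 \<and> W \<subseteq> fixed_pts n" using n_pos assms fixed_pts_n by simp
  then have *: "period W > 0 \<and> W \<subseteq> fixed_pts (period W)" unfolding period_def by (rule LeastI)
  then show "period W > 0" "W \<subseteq> fixed_pts (period W)" by auto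
  fix m
  show "W \<subseteq> fixed_pts m \<longleftrightarrow> period W dvd m"
  proof
    assume "W \<subseteq> fixed_pts m"
    then have W: "W \<subseteq> fixed_pts (m mod period W)" using * fixed_pts_mod by blast
    have lt: "m mod period W < period W" using * by simp
    then have "\<not> (m mod period W > 0 \<and> W \<subseteq> fixed_pts (m mod period W))"
      unfolding period_def by (rule not_less_Least)
    then show "period W dvd m" using W by auto
  next
    assume "period W dvd m"
    then show "W \<subseteq> fixed_pts m" using * fixed_pts_dvd by blast
  qed
qed

text \<open>The group generated by Frobenius acts freely on the nonzero elements of a simple submodule.\<close>
lemma period_dvd_card:
  assumes W: "simple W"
  shows "period W dvd card W - 1"
proof -
  note sW = simple_submod[OF W]
  define e where "e = period W"
  note e = period[OF submodD(1)[OF sW], folded e_def]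
  define orb where "orb w = (\<lambda>i. w [^] (q ^ i)) ` {..<e}" for w
  \<comment> \<open>The points fixed by the \<open>i\<close>-th power of Frobenius form a submodule;
    if it contains a nonzero \<open>w\<close>, it contains all of \<open>W\<close> by
    simplicity.\<close>
  have free: "e dvd i" if "w \<in> W" "w \<noteq> \<zero>" "w \<in> fixed_pts i" for w i
    using frob_span_least[OF submod_fixed_pts that(3)] simple_frob_span[OF W that(1,2)] e(3) by simp
  have fe: "w [^] (q ^ (e * m)) = w" if "w \<in> W" for w m
    using fixed_pts_mult e(2) that fixed_ptsD(2) by blast
  have orb_eq: "orb w = range (\<lambda>i. w [^] (q ^ i))" if w: "w \<in> W" for w
  proof
    show "range (\<lambda>i. w [^] (q ^ i)) \<subseteq> orb w"
    proof clarsimp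
      fix i
      have "w [^] (q ^ (i mod e)) = (w [^] (q ^ (e * (i div e)))) [^] (q ^ (i mod e))"
        using fe[OF w] by simp
      also have "\<dots> = w [^] (q ^ i)" by (simp add: frob_frob[OF submodD(6)[OF sW w]])
      finally have "w [^] (q ^ i) = w [^] (q ^ (i mod e))" by simp
      then show "w [^] (q ^ i) \<in> orb w" unfolding orb_def using e(1) by auto
    qed
  qed (auto simp: orb_def)
  have orb_sub: "orb w \<subseteq> W - {\<zero>}" if w: "w \<in> W - {\<zero>}" for w
  proof -
    have "w [^] (q ^ i) \<noteq> \<zero>" for i
    proof
      assume "w [^] (q ^ i) = \<zero>"
      \<comment> \<open>Another \<open>e * i - i\<close> steps complete the exponent to a multiple
        of \<open>e\<close> and bring back \<open>w\<close>; the subtraction does not truncate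
        because \<open>e > 0\<close>.\<close>
      then have "(w [^] (q ^ i)) [^] (q ^ (e * i - i)) = \<zero>" by simp
      then show False using w fe[of w i] e(1) submodD(6)[OF sW] by (simp add: frob_frob)
    qed
    then show ?thesis using submod_frob[OF sW] w by (auto simp: orb_def)
  qed
  have card_orb: "card (orb w) = e" if w: "w \<in> W - {\<zero>}" for w
  proof -
    have wK: "w \<in> carrier K" using w submodD(6)[OF sW] by auto
    have "inj_on (\<lambda>i. w [^] (q ^ i)) {..<e}"
    proof (rule linorder_inj_onI')
      fix i j assume ij: "i \<in> {..<e}" "j \<in> {..<e}" "i < j"
      show "w [^] (q ^ i) \<noteq> w [^] (q ^ j)"
      proof
        assume "w [^] (q ^ i) = w [^] (q ^ j)"
        then have "(w [^] (q ^ i)) [^] (q ^ (e - i)) = (w [^] (q ^ j)) [^] (q ^ (e - i))" by simp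
        then have "w = w [^] (q ^ (e + (j - i)))"
          using fe[of w 1] w wK ij by (simp add: frob_frob add.commute)
        also have "\<dots> = w [^] (q ^ (j - i))"
          using fe[of w 1] w wK by (simp flip: frob_frob)
        finally have "w \<in> fixed_pts (j - i)" using wK by (simp add: fixed_pts_def)
        then have "e dvd j - i" using free w by auto
        then show False using ij by (auto dest: dvd_imp_le)
      qed
    qed
    then show ?thesis by (simp add: orb_def card_image)
  qed
  have orb_mem: "orb v = orb w" if w: "w \<in> W - {\<zero>}" and v: "v \<in> orb w" for v w
  proof -
    obtain i where i: "i < e" "v = w [^] (q ^ i)" using v by (auto simp: orb_def)
    have vW: "v \<in> W" using orb_sub[OF w] v by auto
    have wK: "w \<in> carrier K" using w submodD(6)[OF sW] by auto
    have "w [^] (q ^ j) = v [^] (q ^ (j + (e - i)))" for j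
    proof -
      have "v [^] (q ^ (j + (e - i))) = w [^] (q ^ (e + j))"
        using i wK by (simp add: frob_frob add.commute)
      also have "\<dots> = w [^] (q ^ j)" using fe[of w 1] w wK by (simp flip: frob_frob)
      finally show ?thesis by simp
    qed
    then have "orb w \<subseteq> orb v" unfolding orb_eq[OF vW] using w by (auto simp: orb_eq)
    moreover have "orb v \<subseteq> orb w" using w wK i unfolding orb_eq[OF vW]
      by (auto simp: orb_eq frob_frob)
    ultimately show ?thesis by blast
  qed
  have self: "w \<in> orb w" if "w \<in> W" for w
    unfolding orb_def using e(1) submodD(6)[OF sW that] by (intro image_eqI[of _ _ 0]) auto
  have Un: "\<Union>(orb ` (W - {\<zero>})) = W - {\<zero>}" using orb_sub self by blast
  \<comment> \<open>The orbits partition the nonzero elements into blocks of size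
    \<open>e\<close>.\<close>
  have "e dvd card (\<Union>(orb ` (W - {\<zero>})))"
  proof (rule dvd_partition)
    show "finite (\<Union>(orb ` (W - {\<zero>})))" unfolding Un using submod_finite[OF sW] by simp
    show "\<forall>c\<in>orb ` (W - {\<zero>}). e dvd card c" using card_orb by auto
    show "\<forall>c1\<in>orb ` (W - {\<zero>}). \<forall>c2\<in>orb ` (W - {\<zero>}). c1 \<noteq> c2 \<longrightarrow> c1 \<inter> c2 = {}"
    proof (intro ballI impI, rule ccontr)
      fix c1 c2 assume A: "c1 \<in> orb ` (W - {\<zero>})" "c2 \<in> orb ` (W - {\<zero>})" "c1 \<noteq> c2" "c1 \<inter> c2 \<noteq> {}"
      then obtain v where "v \<in> c1" "v \<in> c2" by blast
      then have "orb v = c1" "orb v = c2" using A(1,2) orb_mem by blast+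
      then show False using A(3) by simp
    qed
  qed
  then show ?thesis unfolding Un e_def using submod_finite[OF sW] submodD(2)[OF sW] by simp
qed

text \<open>With \<open>card W = q ^ r\<close>, the period divides \<open>q ^ r - 1\<close>, so the
  order of \<open>q\<close> modulo the period divides \<open>r\<close>. As \<open>r > 0\<close>,
  this order is nonzero, which forces coprimality.\<close>

lemma simple_card_period:
  assumes W: "simple W"
  shows "coprime q (period W)" "q ^ ord (period W) q \<le> card W"
proof -
  obtain r where r: "r > 0" "card W = q ^ r" using simple_card_ge[OF W] .
  have "period W dvd q ^ r - 1" using period_dvd_card[OF W] r by simp
  then have "[q ^ r = 1] (mod period W)" using q_gt_1 by (simp add: cong_altdef_nat)
  then have "ord (period W) q dvd r" by (simp add: ord_divides')
  then have "ord (period W) q \<le> r" using r(1) by (rule dvd_imp_le)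
  then show "q ^ ord (period W) q \<le> card W" using r q_gt_1 by simp
  have "ord (period W) q \<noteq> 0"
    using \<open>ord (period W) q dvd r\<close> r(1) by auto
  then show "coprime q (period W)" by (simp add: ord_eq_0 coprime_commute)
qed

end

section \<open>The trace to an intermediate field\<close>

lemma frob_span_carrier_update: "frob_span q (K\<lparr>carrier := S\<rparr>) F \<alpha> = frob_span q K F \<alpha>"
proof
  have pow: "x [^]\<^bsub>K\<lparr>carrier := S\<rparr>\<^esub> (m::nat) = x [^]\<^bsub>K\<^esub> m" for x m
    by (simp add: nat_pow_def)
  show "frob_span q (K\<lparr>carrier := S\<rparr>) F \<alpha> \<subseteq> frob_span q K F \<alpha>"
  proof
    fix x assume "x \<in> frob_span q (K\<lparr>carrier := S\<rparr>) F \<alpha>"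
    then show "x \<in> frob_span q K F \<alpha>"
      by induction (auto simp: pow intro: frob_span.intros)
  qed
  show "frob_span q K F \<alpha> \<subseteq> frob_span q (K\<lparr>carrier := S\<rparr>) F \<alpha>"
  proof
    fix x assume "x \<in> frob_span q K F \<alpha>"
    then show "x \<in> frob_span q (K\<lparr>carrier := S\<rparr>) F \<alpha>"
      by induction (use frob_span.intros[where K = "K\<lparr>carrier := S\<rparr>"] in \<open>auto simp: pow\<close>)
  qed
qed

context finite_ext
begin

text \<open>For \<open>d > 0\<close> these are the coefficients of
  \<open>1 + X^d + ... + X^(d * j)\<close>. For \<open>d\<close> dividing \<open>n\<close> and
  \<open>j = n div d - 1\<close> the operator is the trace onto \<open>fixed_pts d\<close>.\<close>

primrec trace_coeffs :: "nat \<Rightarrow> nat \<Rightarrow> 'a list" where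
  "trace_coeffs d 0 = [\<one>]"
| "trace_coeffs d (Suc j) = \<one> # replicate (d - 1) \<zero> @ trace_coeffs d j"

lemma set_trace_coeffs: "set (trace_coeffs d j) \<subseteq> F"
  by (induction j) auto

lemma trace_coeffs_nonzero: "\<not> set (trace_coeffs d j) \<subseteq> {\<zero>}"
  by (cases j) auto

lemma length_trace_coeffs: "d > 0 \<Longrightarrow> length (trace_coeffs d j) = Suc (d * j)"
  by (induction j) auto

lemma frob_op_trace_coeffs_Suc:
  assumes "d > 0" "x \<in> carrier K"
  shows "frob_op (trace_coeffs d (Suc j)) x = x \<oplus> frob_op (trace_coeffs d j) (x [^] (q ^ d))"
proof -
  have "q * q ^ (d - 1) = q ^ d" using assms(1) by (cases d) auto
  then show ?thesis using assms(2) set_trace_coeffs by (simp add: frob_op_replicate nat_pow_pow)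
qed

lemma frob_op_trace_coeffs_0: "x \<in> carrier K \<Longrightarrow> frob_op (trace_coeffs d 0) x = x"
  by simp

lemma frob_op_trace_coeffs_closed: "x \<in> carrier K \<Longrightarrow> frob_op (trace_coeffs d j) x \<in> carrier K"
  by (simp add: frob_op_closed set_trace_coeffs)

text \<open>The identity \<open>(X^d - 1) * (1 + X^d + ... + X^(d * j)) = X^(d * (j + 1)) -
  1\<close>, arranged without subtraction. For \<open>d * Suc j = n\<close> it shows that traces lie
  in \<open>fixed_pts d\<close>.\<close>

lemma frob_op_trace_coeffs_telescope:
  assumes "d > 0" "x \<in> carrier K"
  shows "frob_op (trace_coeffs d j) x [^] (q ^ d) \<oplus> x = frob_op (trace_coeffs d j) x \<oplus> x [^] (q ^ (d * Suc j))"
  using assms(2)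
proof (induction j arbitrary: x)
  case 0
  then show ?case by (simp add: frob_op_trace_coeffs_0 a_comm del: trace_coeffs.simps)
next
  case (Suc j)
  define y where "y = x [^] (q ^ d)"
  define T where "T = frob_op (trace_coeffs d j) y"
  have [simp]: "x \<in> carrier K" "y \<in> carrier K" "T \<in> carrier K"
    using Suc.prems by (simp_all add: y_def T_def frob_op_trace_coeffs_closed)
  have IH: "T [^] (q ^ d) \<oplus> y = T \<oplus> y [^] (q ^ (d * Suc j))" unfolding T_def by (rule Suc.IH) simp
  have "frob_op (trace_coeffs d (Suc j)) x [^] (q ^ d) \<oplus> x = y \<oplus> T [^] (q ^ d) \<oplus> x"
    using assms(1) by (simp add: frob_op_trace_coeffs_Suc frob_add flip: y_def T_def del: trace_coeffs.simps)
  also have "\<dots> = (T [^] (q ^ d) \<oplus> y) \<oplus> x" by (simp add: a_comm)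
  also have "\<dots> = (x \<oplus> T) \<oplus> y [^] (q ^ (d * Suc j))" unfolding IH by (simp add: a_ac)
  also have "y [^] (q ^ (d * Suc j)) = x [^] (q ^ (d * Suc (Suc j)))"
    unfolding y_def by (simp add: frob_frob)
  also have "x \<oplus> T = frob_op (trace_coeffs d (Suc j)) x"
    using assms(1) by (simp add: frob_op_trace_coeffs_Suc flip: y_def T_def del: trace_coeffs.simps)
  finally show ?case .
qed

lemma frob_op_trace_coeffs_fixed_pts:
  assumes "d > 0" "w \<in> fixed_pts d"
  shows "frob_op (trace_coeffs d j) w = [(Suc j)] \<cdot> w"
proof (induction j)
  case 0
  then show ?case using fixed_ptsD(1)[OF assms(2)] by (simp add: frob_op_trace_coeffs_0 del: trace_coeffs.simps)
next
  case (Suc j)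
  then show ?case using fixed_ptsD[OF assms(2)] assms(1)
    by (simp add: frob_op_trace_coeffs_Suc a_comm del: trace_coeffs.simps)
qed

text \<open>The additive order of \<open>w\<close> divides both \<open>m\<close> and the group order
  \<open>q ^ n\<close>.\<close>

lemma add_pow_eq_zero_coprime:
  assumes "[m] \<cdot> w = \<zero>" "w \<in> carrier K" "coprime q m"
  shows "w = \<zero>"
proof -
  have "add.ord w dvd m" using assms add.pow_eq_id[of w m] by simp
  moreover have "add.ord w dvd q ^ n"
    using add.ord_dvd_group_order[of w] assms(2) card_K by (simp add: Coset.order_def)
  moreover have "coprime (q ^ n) m" using assms(3) by simp
  ultimately have "add.ord w = 1" by (metis coprime_common_divisor_nat)
  then show ?thesis using add.pow_ord_eq_1[OF assms(2)] assms(2) by simp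
qed

text \<open>The image lies in \<open>fixed_pts d\<close>, of size at most \<open>q ^ d\<close>, and
  the kernel has size at most \<open>q ^ (n - d)\<close> by the degree of the operator. Image and
  kernel sizes multiply to \<open>q ^ n\<close>, so both bounds are attained.\<close>

lemma trace_surj:
  fixes d defines "T \<equiv> frob_op (trace_coeffs d (n div d - 1))"
  assumes d: "d dvd n" "d > 0"
  shows "T ` carrier K = fixed_pts d" "card (fixed_pts d) = q ^ d" "card (ker T) = q ^ (n - d)"
proof -
  let ?j = "n div d - 1"
  have "n div d > 0" using d n_pos by (simp add: div_greater_zero_iff dvd_imp_le)
  then have j: "d * Suc ?j = n" using d by simp
  have T: "endo T" unfolding T_def by (rule endo_frob_op[OF set_trace_coeffs])
  have sub: "T ` carrier K \<subseteq> fixed_pts d"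
  proof
    fix y assume "y \<in> T ` carrier K"
    then obtain x where x: "x \<in> carrier K" "y = T x" by auto
    have y: "y \<in> carrier K" using x endoD(1)[OF T] by simp
    have "y [^] (q ^ d) \<oplus> x = y \<oplus> x"
      using frob_op_trace_coeffs_telescope[OF d(2) x(1), of ?j] frob_n[OF x(1)] unfolding j x(2) T_def by simp
    then show "y \<in> fixed_pts d" using x(1) y by (simp add: fixed_pts_def)
  qed
  have "card (ker T) \<le> q ^ (d * ?j)"
    unfolding T_def by (rule frob_op_ker_card_le) (simp_all add: set_trace_coeffs trace_coeffs_nonzero length_trace_coeffs d)
  also have "d * ?j = n - d" using j by simp
  finally have ker: "card (ker T) \<le> q ^ (n - d)" .
  have im: "card (T ` carrier K) \<le> card (fixed_pts d)"
    using sub submod_finite[OF submod_fixed_pts] by (rule card_mono[rotated])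
  have fd: "card (fixed_pts d) \<le> q ^ d" by (rule fixed_pts_card_le[OF d(2)])
  have "carrier K \<inter> ker T = ker T" by blast
  then have prod: "card (ker T) * card (T ` carrier K) = q ^ (n - d) * q ^ d"
    using card_ker_image[OF T submod_carrier] card_K d n_pos
    by (simp add: dvd_imp_le flip: power_add)
  have pos: "q ^ (n - d) > 0" "q ^ d > 0" using q_gt_1 by auto
  have "card (T ` carrier K) = q ^ d"
  proof (rule ccontr)
    assume "card (T ` carrier K) \<noteq> q ^ d"
    then have "card (T ` carrier K) < q ^ d" using im fd by simp
    then have "q ^ (n - d) * card (T ` carrier K) < q ^ (n - d) * q ^ d"
      using pos by (simp only: nat_mult_less_cancel1)
    moreover have "card (ker T) * card (T ` carrier K) \<le> q ^ (n - d) * card (T ` carrier K)"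
      using ker by (rule mult_le_mono1)
    ultimately have "card (ker T) * card (T ` carrier K) < q ^ (n - d) * q ^ d" by linarith
    then show False using prod by simp
  qed
  then show *: "card (fixed_pts d) = q ^ d" "card (ker T) = q ^ (n - d)"
    using im fd prod pos by simp_all
  show "T ` carrier K = fixed_pts d"
    using sub * \<open>card (T ` carrier K) = q ^ d\<close> submod_finite[OF submod_fixed_pts]
    by (intro card_subset_eq) auto
qed

text \<open>\<open>T\<close> maps \<open>fspan \<alpha>\<close> onto
  \<open>fspan (T \<alpha>)\<close>, and by assumption the kernel of this map is all of
  \<open>ker T\<close>, of size \<open>q ^ (n - d)\<close>.\<close>

lemma card_frob_span_trace:
  fixes d defines "T \<equiv> frob_op (trace_coeffs d (n div d - 1))"
  assumes d: "d dvd n" "d > 0" and a: "\<alpha> \<in> carrier K" and sub: "ker T \<subseteq> fspan \<alpha>"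
  shows "card (fspan \<alpha>) = q ^ (n - d) * card (fspan (T \<alpha>))"
proof -
  have T: "endo T" unfolding T_def by (rule endo_frob_op[OF set_trace_coeffs])
  have Ta: "T \<alpha> \<in> carrier K" using endoD(1)[OF T a] .
  have "T ` fspan \<alpha> = fspan (T \<alpha>)"
  proof
    have "fspan \<alpha> \<subseteq> {x \<in> carrier K. T x \<in> fspan (T \<alpha>)}"
      using a Ta frob_span_base by (intro frob_span_least submod_vimage[OF T] frob_span_submod) auto
    then show "T ` fspan \<alpha> \<subseteq> fspan (T \<alpha>)" by auto
    show "fspan (T \<alpha>) \<subseteq> T ` fspan \<alpha>"
      using a frob_span_base by (intro frob_span_least submod_image[OF T] frob_span_submod imageI)
  qed
  moreover have "fspan \<alpha> \<inter> ker T = ker T" using sub by auto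
  ultimately show ?thesis
    using card_ker_image[OF T frob_span_submod[OF a]] trace_surj(3)[OF d] by (simp add: T_def)
qed

section \<open>Defects and the trace\<close>

text \<open>The dimension \<open>m\<close> is a parameter because the notion is used for
  \<open>K\<close> with \<open>m = n\<close> and for \<open>fixed_pts d\<close> with
  \<open>m = d\<close>.\<close>

definition defect :: "nat \<Rightarrow> nat \<Rightarrow> 'a \<Rightarrow> bool" where
  "defect m k \<alpha> \<longleftrightarrow> k \<le> m \<and> card (fspan \<alpha>) = q ^ (m - k)"

text \<open>The trace divides the size by \<open>q ^ (n - d)\<close>, which preserves the defect for
  \<open>k \<le> d\<close>. For \<open>k > d\<close> neither side holds:
  \<open>fspan \<alpha>\<close> contains the \<open>q ^ (n - d)\<close> elements of
  \<open>ker T\<close>.\<close>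

lemma defect_trace:
  fixes d defines "T \<equiv> frob_op (trace_coeffs d (n div d - 1))"
  assumes d: "d dvd n" "d > 0" and a: "\<alpha> \<in> carrier K" and sub: "ker T \<subseteq> fspan \<alpha>"
  shows "defect n k \<alpha> \<longleftrightarrow> defect d k (T \<alpha>)"
proof -
  have dn: "d \<le> n" using d n_pos by (simp add: dvd_imp_le)
  note c = card_frob_span_trace[OF d a sub[unfolded T_def], folded T_def]
  have Ta: "T \<alpha> \<in> carrier K" unfolding T_def using a by (rule frob_op_trace_coeffs_closed)
  have pos: "card (fspan (T \<alpha>)) \<ge> 1"
    using submod_finite[OF frob_span_submod[OF Ta]] frob_span_base[of "T \<alpha>" q K F] by (simp add: Suc_le_eq card_gt_0_iff) blast
  show ?thesis
  proof (cases "k \<le> d")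
    case True
    then have "q ^ (n - k) = q ^ (n - d) * q ^ (d - k)" using dn by (simp flip: power_add)
    then show ?thesis using True dn q_gt_1 unfolding defect_def c by simp
  next
    case False
    have "\<not> defect n k \<alpha>"
    proof
      assume "defect n k \<alpha>"
      then have *: "q ^ (n - d) * card (fspan (T \<alpha>)) = q ^ (n - k)" "k \<le> n" unfolding defect_def c by auto
      have "q ^ (n - k) < q ^ (n - d)" using False * q_gt_1 by (intro power_strict_increasing) auto
      also have "\<dots> \<le> q ^ (n - d) * card (fspan (T \<alpha>))" using pos by simp
      finally show False using * by simp
    qed
    then show ?thesis using False unfolding defect_def by simp
  qed
qed

text \<open>A union bound over the simple submodules \<open>W\<close> of \<open>ker T\<close>: a bad
  element lies in the image of the operator attached to some \<open>W\<close>, this image has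
  \<open>q ^ n / card W\<close> elements, and at most \<open>e\<close> of the \<open>W\<close> have
  period \<open>e\<close>.\<close>

lemma card_not_generating_le:
  fixes d defines "T \<equiv> frob_op (trace_coeffs d (n div d - 1))"
  assumes d: "d dvd n" "d > 0" and cop: "coprime q (n div d)"
  shows "real (card {\<alpha> \<in> carrier K. \<not> ker T \<subseteq> fspan \<alpha>}) \<le>
    (\<Sum>e | e dvd n \<and> \<not> e dvd d \<and> coprime q e. real e * (real q ^ n / real q ^ ord e q))"
proof -
  have T: "endo T" unfolding T_def by (rule endo_frob_op[OF set_trace_coeffs])
  \<comment> \<open>One operator is fixed for every \<open>W\<close>, so that the cover below
    consists of one image for each \<open>W\<close>.\<close>
  have "\<forall>W. \<exists>cs. simple W \<longrightarrow> set cs \<subseteq> F \<and> ker (frob_op cs) = W"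
    using simple_eq_ker by metis
  then obtain sel where sel: "\<And>W. simple W \<Longrightarrow> set (sel W) \<subseteq> F" "\<And>W. simple W \<Longrightarrow> ker (frob_op (sel W)) = W"
    by metis
  define E where "E = {e. e dvd n \<and> \<not> e dvd d \<and> coprime q e}"
  define S where "S e = {W. simple W \<and> period W = e}" for e
  have finE: "finite E" unfolding E_def using n_pos by simp
  have Epos: "e > 0" if "e \<in> E" for e using that n_pos unfolding E_def by (auto intro!: Nat.gr0I)
  have fixS: "simple W \<and> W \<subseteq> fixed_pts e" if "W \<in> S e" for W e
    using that period(2)[OF submodD(1)[OF simple_submod]] unfolding S_def by auto
  have cS: "finite (S e)" "card (S e) \<le> e" if "e \<in> E" for e
    using card_simple_le[OF Epos[OF that], of "S e"] fixS by blast+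
  have "n div d > 0" using d n_pos by (simp add: div_greater_zero_iff dvd_imp_le)
  \<comment> \<open>On \<open>fixed_pts d\<close> the trace is multiplication by
    \<open>n div d\<close>, injective by coprimality. Hence no simple submodule of the kernel has a
    period dividing \<open>d\<close>.\<close>
  have trivial: "ker T \<inter> fixed_pts d \<subseteq> {\<zero>}"
  proof
    fix w assume w: "w \<in> ker T \<inter> fixed_pts d"
    then have "[(n div d)] \<cdot> w = \<zero>"
      using frob_op_trace_coeffs_fixed_pts[OF d(2), of w "n div d - 1"] \<open>n div d > 0\<close> by (simp add: T_def)
    moreover have "w \<in> carrier K" using w by blast
    ultimately have "w = \<zero>" using cop by (rule add_pow_eq_zero_coprime)
    then show "w \<in> {\<zero>}" by simp
  qed
  have "{\<alpha> \<in> carrier K. \<not> ker T \<subseteq> fspan \<alpha>} \<subseteq> (\<Union>e\<in>E. \<Union>W\<in>S e. frob_op (sel W) ` carrier K)"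
  proof
    fix \<alpha> assume \<alpha>: "\<alpha> \<in> {\<alpha> \<in> carrier K. \<not> ker T \<subseteq> fspan \<alpha>}"
    then obtain W where W: "simple W" "W \<subseteq> ker T" "\<alpha> \<in> frob_op (sel W) ` carrier K"
      using not_generating_in_image[OF _ submod_ker[OF T] _ sel] by blast
    note WK = submodD(1)[OF simple_submod[OF W(1)]]
    have "period W dvd n" using period(3)[OF WK, of n] WK fixed_pts_n by simp
    moreover have "\<not> period W dvd d"
    proof
      assume "period W dvd d"
      then have "W \<subseteq> fixed_pts d" using period(3)[OF WK] by simp
      then show False using trivial W(2) simple_nonzero[OF W(1)] by blast
    qed
    ultimately have "period W \<in> E" using simple_card_period(1)[OF W(1)] by (simp add: E_def)
    moreover have "W \<in> S (period W)" using W(1) by (simp add: S_def)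
    ultimately show "\<alpha> \<in> (\<Union>e\<in>E. \<Union>W\<in>S e. frob_op (sel W) ` carrier K)" using W(3) by blast
  qed
  then have "card {\<alpha> \<in> carrier K. \<not> ker T \<subseteq> fspan \<alpha>} \<le> card (\<Union>e\<in>E. \<Union>W\<in>S e. frob_op (sel W) ` carrier K)"
    by (intro card_mono finite_UN_I finE cS finite_imageI finite_K)
  also have "\<dots> \<le> (\<Sum>e\<in>E. card (\<Union>W\<in>S e. frob_op (sel W) ` carrier K))"
    by (rule card_UN_le[OF finE])
  also have "\<dots> \<le> (\<Sum>e\<in>E. \<Sum>W\<in>S e. card (frob_op (sel W) ` carrier K))"
    by (intro sum_mono card_UN_le cS)
  finally have "real (card {\<alpha> \<in> carrier K. \<not> ker T \<subseteq> fspan \<alpha>})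
      \<le> real (\<Sum>e\<in>E. \<Sum>W\<in>S e. card (frob_op (sel W) ` carrier K))" by (simp only: of_nat_le_iff)
  also have "\<dots> = (\<Sum>e\<in>E. \<Sum>W\<in>S e. real (card (frob_op (sel W) ` carrier K)))" by simp
  also have "\<dots> \<le> (\<Sum>e\<in>E. \<Sum>W\<in>S e. real q ^ n / real q ^ ord e q)"
  proof (intro sum_mono)
    fix e W assume "e \<in> E" "W \<in> S e"
    then have W: "simple W" "period W = e" by (auto simp: S_def)
    have "real (q ^ ord e q) * real (card (frob_op (sel W) ` carrier K))
        \<le> real (card W) * real (card (frob_op (sel W) ` carrier K))"
      using simple_card_period(2)[OF W(1)] unfolding W(2)
      by (intro mult_right_mono) (simp_all only: of_nat_le_iff of_nat_0_le_iff)
    also have "\<dots> = real q ^ n"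
      using card_image_frob_op[OF sel(1)[OF W(1)] sel(2)[OF W(1)]] by (metis of_nat_mult of_nat_power)
    finally show "real (card (frob_op (sel W) ` carrier K)) \<le> real q ^ n / real q ^ ord e q"
      using q_gt_1 by (simp add: field_simps)
  qed
  also have "\<dots> \<le> (\<Sum>e\<in>E. real e * (real q ^ n / real q ^ ord e q))"
  proof (intro sum_mono)
    fix e assume "e \<in> E"
    then show "(\<Sum>W\<in>S e. real q ^ n / real q ^ ord e q) \<le> real e * (real q ^ n / real q ^ ord e q)"
      using cS(2)[of e] by (simp only: sum_constant) (intro mult_right_mono, simp_all)
  qed
  finally show ?thesis unfolding E_def .
qed

section \<open>Densities in \<open>K\<close> and in its intermediate fields\<close>

lemma k_normal_density_eq:
  "k_normal_density q n k K F = real (card {\<alpha> \<in> carrier K. defect n k \<alpha>}) / real q ^ n"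
proof -
  have "{\<alpha> \<in> carrier K. k_normal q n k K F \<alpha>} = {\<alpha> \<in> carrier K. defect n k \<alpha>}"
    using k_normal_iff by (auto simp: defect_def)
  then show ?thesis by (simp add: k_normal_density_def k_normal_count_def)
qed

lemma k_normal_density_bounds: "0 \<le> k_normal_density q n k K F \<and> k_normal_density q n k K F \<le> 1"
proof -
  have "card {\<alpha> \<in> carrier K. defect n k \<alpha>} \<le> q ^ n"
    unfolding card_K[symmetric] by (intro card_mono) auto
  then have "real (card {\<alpha> \<in> carrier K. defect n k \<alpha>}) \<le> real q ^ n" by (simp flip: of_nat_power)
  then show ?thesis using q_gt_1 by (simp add: k_normal_density_eq divide_le_eq_1)
qed

lemma F_subset_fixed_pts: "F \<subseteq> fixed_pts d"
  using frob_F by (auto simp: fixed_pts_def)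

lemma subfield_fixed_pts: "subfield (fixed_pts d) K"
proof (rule subfieldI')
  have uminus: "\<ominus> x \<in> fixed_pts d" if "x \<in> fixed_pts d" for x
    using submod_uminus[OF submod_fixed_pts that] .
  show "subring (fixed_pts d) K"
  proof (rule subringI)
    show "fixed_pts d \<subseteq> carrier K" by (rule submodD(1)[OF submod_fixed_pts])
    show "\<one> \<in> fixed_pts d" by (simp add: fixed_pts_def)
    fix x y assume "x \<in> fixed_pts d" "y \<in> fixed_pts d"
    then show "x \<otimes> y \<in> fixed_pts d" "x \<oplus> y \<in> fixed_pts d"
      by (simp_all add: fixed_pts_def nat_pow_distrib frob_add)
  qed (rule uminus)
  fix k assume k: "k \<in> fixed_pts d - {\<zero>}"
  then have kK: "k \<in> carrier K" "k [^] (q ^ d) = k" by (auto simp: fixed_pts_def)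
  have inv: "inv k \<in> carrier K" "k \<otimes> inv k = \<one>" using k kK field_Units by auto
  have "k \<otimes> inv k [^] (q ^ d) = (k \<otimes> inv k) [^] (q ^ d)"
    using kK inv(1) by (simp add: nat_pow_distrib)
  then have "inv k = inv k [^] (q ^ d)" using inv kK by (intro comm_inv_char) auto
  then show "inv k \<in> fixed_pts d" using inv(1) by (simp add: fixed_pts_def)
qed

lemma finite_ext_fixed_pts:
  assumes "d dvd n" "d > 0"
  shows "finite_ext (K\<lparr>carrier := fixed_pts d\<rparr>) F q d"
proof -
  interpret S: field "K\<lparr>carrier := fixed_pts d\<rparr>" using subfield_fixed_pts by (rule subfield_iff(2))
  have "subfield F (K\<lparr>carrier := fixed_pts d\<rparr>)"
    using subfield_iff(2)[OF subfield_F] F_subset_fixed_pts by (intro S.subfield_iff(1)) auto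
  then show ?thesis
    using primepow card_F trace_surj(2)[OF assms] assms(2)
    by (intro finite_ext.intro finite_ext_axioms.intro S.field_axioms) simp_all
qed

lemma density_fixed_pts_eq:
  assumes "d dvd n" "d > 0"
  shows "k_normal_density q d k (K\<lparr>carrier := fixed_pts d\<rparr>) F
    = real (card {\<beta> \<in> fixed_pts d. defect d k \<beta>}) / real q ^ d"
proof -
  interpret S: finite_ext "K\<lparr>carrier := fixed_pts d\<rparr>" F q d by (rule finite_ext_fixed_pts[OF assms])
  show ?thesis unfolding S.k_normal_density_eq S.defect_def defect_def by (simp add: frob_span_carrier_update)
qed

text \<open>Outside the bad set \<open>C\<close> an element and its trace have the same defect, so
  \<open>A\<close> and \<open>B\<close> differ only within \<open>C\<close>. All fibres of the trace
  have \<open>q ^ (n - d)\<close> elements, so the proportion of \<open>B\<close> in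
  \<open>K\<close> is the density for \<open>d\<close>.\<close>

lemma density_compare:
  assumes d: "d dvd n" "d > 0" and cop: "coprime q (n div d)"
  shows "\<bar>k_normal_density q n k K F - k_normal_density q d k (K\<lparr>carrier := fixed_pts d\<rparr>) F\<bar>
    \<le> (\<Sum>e | e dvd n \<and> \<not> e dvd d \<and> coprime q e. real e / real q ^ ord e q)"
proof -
  define T where "T = frob_op (trace_coeffs d (n div d - 1))"
  have T: "endo T" unfolding T_def by (rule endo_frob_op[OF set_trace_coeffs])
  define A where "A = {\<alpha> \<in> carrier K. defect n k \<alpha>}"
  define B where "B = {\<alpha> \<in> carrier K. T \<alpha> \<in> {\<beta> \<in> fixed_pts d. defect d k \<beta>}}"
  define C where "C = {\<alpha> \<in> carrier K. \<not> ker T \<subseteq> fspan \<alpha>}"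
  have fin: "finite A" "finite B" "finite C" by (simp_all add: A_def B_def C_def)
  have im: "T x \<in> fixed_pts d" if "x \<in> carrier K" for x
    using trace_surj(1)[OF d] that unfolding T_def by blast
  have good: "\<alpha> \<in> A \<longleftrightarrow> \<alpha> \<in> B" if "\<alpha> \<in> carrier K" "\<alpha> \<notin> C" for \<alpha>
    using defect_trace[OF d that(1), of k] that im unfolding A_def B_def C_def T_def by auto
  have "A \<subseteq> B \<union> C" "B \<subseteq> A \<union> C" using good by (auto simp: A_def B_def)
  then have "card A \<le> card (B \<union> C)" "card B \<le> card (A \<union> C)"
    using fin by (simp_all add: card_mono)
  then have "card A \<le> card B + card C" "card B \<le> card A + card C"
    using card_Un_le[of B C] card_Un_le[of A C] by linarith+
  then have AB: "\<bar>real (card A) - real (card B)\<bar> \<le> real (card C)" by linarith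
  have "carrier K \<inter> ker T = ker T" by blast
  moreover have "T ` carrier K \<inter> {\<beta> \<in> fixed_pts d. defect d k \<beta>} = {\<beta> \<in> fixed_pts d. defect d k \<beta>}"
    using trace_surj(1)[OF d] unfolding T_def by blast
  moreover have "card (ker T) = q ^ (n - d)" using trace_surj(3)[OF d] unfolding T_def .
  ultimately have "card B = q ^ (n - d) * card {\<beta> \<in> fixed_pts d. defect d k \<beta>}"
    using card_vimage_endo[OF T submod_carrier, of "{\<beta> \<in> fixed_pts d. defect d k \<beta>}"]
    unfolding B_def by (simp only:)
  then have cB: "real (card B) = real q ^ (n - d) * real (card {\<beta> \<in> fixed_pts d. defect d k \<beta>})" by simp
  have "real q ^ n = real q ^ (n - d) * real q ^ d"
    using d n_pos by (simp add: dvd_imp_le flip: power_add)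
  then have "real (card B) / real q ^ n = k_normal_density q d k (K\<lparr>carrier := fixed_pts d\<rparr>) F"
    using q_gt_1 unfolding density_fixed_pts_eq[OF d] cB by simp
  moreover have "real (card A) / real q ^ n = k_normal_density q n k K F"
    by (simp add: k_normal_density_eq A_def)
  moreover have "\<bar>real (card A) / real q ^ n - real (card B) / real q ^ n\<bar> \<le> real (card C) / real q ^ n"
    using AB q_gt_1 by (simp add: divide_right_mono flip: diff_divide_distrib)
  moreover have "real (card C) / real q ^ n
      \<le> (\<Sum>e | e dvd n \<and> \<not> e dvd d \<and> coprime q e. real e / real q ^ ord e q)"
  proof -
    have "(\<Sum>e | e dvd n \<and> \<not> e dvd d \<and> coprime q e. real e * (real q ^ n / real q ^ ord e q))
        = (\<Sum>e | e dvd n \<and> \<not> e dvd d \<and> coprime q e. real e / real q ^ ord e q) * real q ^ n"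
      by (simp add: sum_distrib_right)
    then show ?thesis
      using card_not_generating_le[OF d cop, folded T_def] q_gt_1 by (simp add: pos_divide_le_eq C_def)
  qed
  ultimately show ?thesis by simp
qed

text \<open>Shows that \<open>F\<close> is determined by \<open>K\<close> and \<open>q\<close>, so
  that isomorphisms of the large fields match the small ones.\<close>

lemma F_eq_fixed_pts: "F = fixed_pts 1"
  using F_subset_fixed_pts fixed_pts_card_le[of 1] card_F submod_finite[OF submod_fixed_pts, of 1]
  by (intro card_seteq) auto

end

section \<open>Independence of the density from the chosen fields\<close>

lemma finite_ext_iff:
  assumes "primepow q" "n > 0"
  shows "finite_ext K F q n \<longleftrightarrow> finite_field_ext q n K F"
  using assms by (auto simp: finite_ext_def finite_ext_axioms_def finite_field_ext_def)

text \<open>An isomorphism of \<open>K\<close> and \<open>K'\<close> takes \<open>F\<close> to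
  \<open>F'\<close>, both being fixed by the \<open>q\<close>-power map, and hence generated
  submodules to generated submodules of the same size.\<close>

lemma k_normal_density_unique:
  fixes K :: "('a, 'b) ring_scheme" and K' :: "('c, 'd) ring_scheme"
  assumes "finite_ext K F q n" "finite_ext K' F' q n"
  shows "k_normal_density q n k K F = k_normal_density q n k K' F'"
proof -
  interpret K: finite_ext K F q n by fact
  interpret K': finite_ext K' F' q n by fact
  obtain p l where p: "prime p" "q = p ^ l" using K.primepow by (auto simp: primepow_def)
  obtain \<phi> where \<phi>: "\<phi> \<in> ring_hom K K'" "bij_betw \<phi> (carrier K) (carrier K')"
    using finite_field_iso[OF K.field_axioms K'.field_axioms, of p "l * n"] K.card_K K'.card_K p
    by (auto simp: power_mult)
  interpret h: ring_hom_ring K K' \<phi>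
    by (rule ring_hom_ringI2) (use \<phi> K.ring_axioms K'.ring_axioms in auto)
  have inj: "inj_on \<phi> (carrier K)" and img: "\<phi> ` carrier K = carrier K'"
    using \<phi>(2) by (auto simp: bij_betw_def)
  have pow: "\<phi> (x [^]\<^bsub>K\<^esub> m) = \<phi> x [^]\<^bsub>K'\<^esub> m" if "x \<in> carrier K" for x and m :: nat
    using that by (rule h.hom_nat_pow)
  have F: "\<phi> x \<in> F' \<longleftrightarrow> x \<in> F" if "x \<in> carrier K" for x
    unfolding K.F_eq_fixed_pts K'.F_eq_fixed_pts K.fixed_pts_def K'.fixed_pts_def
    using that inj_on_eq_iff[OF inj, of "x [^]\<^bsub>K\<^esub> q" x] by (simp flip: pow)
  have frob_span: "\<phi> ` frob_span q K F \<alpha> = frob_span q K' F' (\<phi> \<alpha>)" if a: "\<alpha> \<in> carrier K" for \<alpha>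
  proof
    note sub = K.submodD(6)[OF K.frob_span_submod[OF a]]
    have "\<phi> x \<in> frob_span q K' F' (\<phi> \<alpha>)" if "x \<in> frob_span q K F \<alpha>" for x
      using that
    proof induction
      case (frob_span_smult c x)
      then show ?case using F[of c] sub[of x] by (auto intro: frob_span.intros)
    qed (use sub in \<open>auto simp: pow intro: frob_span.intros\<close>)
    then show "\<phi> ` frob_span q K F \<alpha> \<subseteq> frob_span q K' F' (\<phi> \<alpha>)" by auto
    show "frob_span q K' F' (\<phi> \<alpha>) \<subseteq> \<phi> ` frob_span q K F \<alpha>"
    proof
      fix y assume "y \<in> frob_span q K' F' (\<phi> \<alpha>)"
      then show "y \<in> \<phi> ` frob_span q K F \<alpha>"
      proof induction
        case frob_span_base
        show ?case by (intro imageI frob_span.intros)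
      next
        case (frob_span_add y z)
        then obtain u v where "y = \<phi> u" "u \<in> frob_span q K F \<alpha>" "z = \<phi> v" "v \<in> frob_span q K F \<alpha>" by auto
        then show ?case using sub by (intro image_eqI[of _ _ "u \<oplus>\<^bsub>K\<^esub> v"]) (auto intro: frob_span.intros)
      next
        case (frob_span_smult c y)
        then obtain u where u: "y = \<phi> u" "u \<in> frob_span q K F \<alpha>" by auto
        have "c \<in> carrier K'" using frob_span_smult by simp
        then obtain b where b: "b \<in> carrier K" "c = \<phi> b" using img by auto
        then have "b \<in> F" using F frob_span_smult by simp
        then show ?case using sub b u by (intro image_eqI[of _ _ "b \<otimes>\<^bsub>K\<^esub> u"]) (auto intro: frob_span.intros)
      next
        case (frob_span_frob y)
        then obtain u where "y = \<phi> u" "u \<in> frob_span q K F \<alpha>" by auto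
        then show ?case using sub by (intro image_eqI[of _ _ "u [^]\<^bsub>K\<^esub> q"]) (auto simp: pow intro: frob_span.intros)
      qed
    qed
  qed
  have defect: "K'.defect n k (\<phi> \<alpha>) \<longleftrightarrow> K.defect n k \<alpha>" if a: "\<alpha> \<in> carrier K" for \<alpha>
  proof -
    have "card (frob_span q K' F' (\<phi> \<alpha>)) = card (frob_span q K F \<alpha>)"
      unfolding frob_span[OF a, symmetric] using inj K.submodD(1)[OF K.frob_span_submod[OF a]]
      by (intro card_image) (rule inj_on_subset)
    then show ?thesis by (simp add: K.defect_def K'.defect_def)
  qed
  have "\<phi> ` {\<alpha> \<in> carrier K. K.defect n k \<alpha>} = {\<alpha> \<in> carrier K'. K'.defect n k \<alpha>}"
    unfolding img[symmetric] using defect by auto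
  moreover have "inj_on \<phi> {\<alpha> \<in> carrier K. K.defect n k \<alpha>}" using inj by (rule inj_on_subset) auto
  ultimately have "card {\<alpha> \<in> carrier K. K.defect n k \<alpha>} = card {\<alpha> \<in> carrier K'. K'.defect n k \<alpha>}"
    by (metis card_image)
  then show ?thesis by (simp add: K.k_normal_density_eq K'.k_normal_density_eq)
qed

section \<open>Mean values\<close>

text \<open>The map \<open>d\<close> to \<open>N div d\<close> injects the divisors above the square
  root of \<open>N\<close> into those below or equal to it.\<close>

lemma card_divisors_le:
  fixes N :: nat
  assumes "N > 0"
  shows "real (card {d. d dvd N}) \<le> 2 * sqrt (real N)"
proof -
  define A where "A = {d. d dvd N \<and> d * d \<le> N}"
  define B where "B = {d. d dvd N \<and> d * d > N}"
  define s where "s = nat \<lfloor>sqrt (real N)\<rfloor>"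
  have fin: "finite {d. d dvd N}" using assms by simp
  have sub: "A \<subseteq> {1..s}"
  proof
    fix d assume d: "d \<in> A"
    then have "real d ^ 2 \<le> real N" unfolding A_def power2_eq_square by (simp flip: of_nat_mult)
    then have "real d \<le> sqrt (real N)" by (rule real_le_rsqrt)
    then have "d \<le> s" unfolding s_def by (rule le_nat_floor)
    moreover have "d > 0" using d assms by (auto simp: A_def intro!: Nat.gr0I)
    ultimately show "d \<in> {1..s}" by simp
  qed
  then have cA: "card A \<le> s" using card_mono[OF _ sub] by simp
  have "(\<lambda>d. N div d) ` B \<subseteq> A"
  proof
    fix c assume "c \<in> (\<lambda>d. N div d) ` B"
    then obtain d where d: "d dvd N" "d * d > N" "c = N div d" by (auto simp: B_def)
    then have cd: "c * d = N" by simp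
    have "c < d"
    proof (rule ccontr)
      assume "\<not> c < d"
      then have "d * d \<le> c * d" by simp
      then show False using cd d(2) by simp
    qed
    then have "c * c \<le> c * d" by simp
    moreover have "c dvd N" using cd by (metis dvd_triv_left)
    ultimately show "c \<in> A" using cd by (simp add: A_def)
  qed
  moreover have "inj_on (\<lambda>d. N div d) B"
  proof (rule inj_onI)
    fix x y assume xy: "x \<in> B" "y \<in> B" "N div x = N div y"
    then have "N div x * x = N" "N div x * y = N" by (auto simp: B_def)
    then show "x = y" using assms by (metis mult_cancel1 mult_zero_left less_irrefl)
  qed
  moreover have "finite A" using fin by (rule finite_subset[rotated]) (auto simp: A_def)
  ultimately have "card B \<le> card A" by (metis card_inj_on_le)
  moreover have "{d. d dvd N} = A \<union> B" by (auto simp: A_def B_def)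
  then have "card {d. d dvd N} \<le> card A + card B" by (metis card_Un_le)
  ultimately have "real (card {d. d dvd N}) \<le> 2 * real s" using cA by linarith
  also have "real s \<le> sqrt (real N)" unfolding s_def by (rule of_nat_floor) simp
  finally show ?thesis by simp
qed

text \<open>If \<open>e\<close> is not coprime to \<open>q\<close>, then \<open>ord e q\<close> is 0
  and the quotient would be 1, which would make the sum diverge; hence the value 0 there.\<close>

definition ord_weight :: "nat \<Rightarrow> nat \<Rightarrow> real" where
  "ord_weight q e = (if e > 0 \<and> coprime q e then 1 / real q ^ ord e q else 0)"

lemma ord_weight_nonneg: "ord_weight q e \<ge> 0"
  by (simp add: ord_weight_def)

text \<open>An \<open>e\<close> with \<open>ord e q = r\<close> divides \<open>q ^ r - 1\<close>, so there are at most \<open>2 * sqrt q ^ r\<close> of them.\<close>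
lemma summable_ord_weight:
  assumes q: "q > 1"
  shows "summable (ord_weight q)"
proof (rule summableI_nonneg_bounded[OF ord_weight_nonneg])
  fix m
  define S where "S = {e. e < m \<and> e > 0 \<and> coprime q e}"
  \<comment> \<open>The \<open>e\<close> with \<open>ord e q = r\<close> contribute at most
    \<open>2 * sqrt (q ^ r) / q ^ r\<close>, a term of a geometric series with ratio
    \<open>c\<close>.\<close>
  define c where "c = 1 / sqrt (real q)"
  have c: "0 \<le> c" "c < 1" using q by (simp_all add: c_def)
  have finS: "finite S" by (simp add: S_def)
  have level: "(\<Sum>e\<in>{e \<in> S. ord e q = r}. ord_weight q e) \<le> 2 * c ^ r" for r
  proof (cases "r = 0")
    case True
    have "{e \<in> S. ord e q = r} = {}" using True by (auto simp: S_def ord_eq_0 coprime_commute)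
    then show ?thesis unfolding \<open>{e \<in> S. ord e q = r} = {}\<close> using c by simp
  next
    case False
    define N where "N = q ^ r - 1"
    have "q ^ r > 1" using q False by (intro one_less_power) auto
    then have N: "N > 0" "N \<le> q ^ r" by (simp_all add: N_def)
    have sub: "{e \<in> S. ord e q = r} \<subseteq> {e. e dvd N}"
    proof
      fix e assume "e \<in> {e \<in> S. ord e q = r}"
      then have "[q ^ r = 1] (mod e)" using ord[of q e] by auto
      then show "e \<in> {e. e dvd N}" using \<open>q ^ r > 1\<close> by (simp add: N_def cong_altdef_nat)
    qed
    have "real (card {e \<in> S. ord e q = r}) \<le> real (card {e. e dvd N})"
      using N sub by (simp add: card_mono)
    also have "\<dots> \<le> 2 * sqrt (real N)" using N(1) by (rule card_divisors_le)
    also have "\<dots> \<le> 2 * sqrt (real q ^ r)" using N(2) by (simp flip: of_nat_power)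
    also have "\<dots> = 2 * sqrt (real q) ^ r" by (simp add: real_sqrt_power)
    finally have card: "real (card {e \<in> S. ord e q = r}) \<le> 2 * sqrt (real q) ^ r" .
    have "(\<Sum>e\<in>{e \<in> S. ord e q = r}. ord_weight q e) = (\<Sum>e\<in>{e \<in> S. ord e q = r}. 1 / real q ^ r)"
      by (intro sum.cong refl) (auto simp: ord_weight_def S_def)
    also have "\<dots> = real (card {e \<in> S. ord e q = r}) / real q ^ r" by simp
    also have "\<dots> \<le> 2 * sqrt (real q) ^ r / real q ^ r" using card by (rule divide_right_mono) simp
    also have "\<dots> = 2 * (sqrt (real q) / real q) ^ r" by (simp add: power_divide)
    also have "sqrt (real q) / real q = c" unfolding c_def using q by (simp add: real_div_sqrt field_simps)
    finally show ?thesis .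
  qed
  have "(\<Sum>e<m. ord_weight q e) = (\<Sum>e\<in>S. ord_weight q e)"
    by (intro sum.mono_neutral_right) (auto simp: S_def ord_weight_def)
  also have "\<dots> = (\<Sum>r\<in>(\<lambda>e. ord e q) ` S. \<Sum>e\<in>{e \<in> S. ord e q = r}. ord_weight q e)"
    using finS by (rule sum.image_gen)
  also have "\<dots> \<le> (\<Sum>r\<in>(\<lambda>e. ord e q) ` S. 2 * c ^ r)" by (intro sum_mono level)
  also have "\<dots> \<le> (\<Sum>r. 2 * c ^ r)"
    using c finS by (intro sum_le_suminf summable_mult summable_geometric) auto
  finally show "(\<Sum>e<m. ord_weight q e) \<le> (\<Sum>r. 2 * c ^ r)" .
qed

lemma card_multiples_le:
  assumes "e > 0"
  shows "real (card {n \<in> {1..N}. e dvd n}) \<le> real N / real e"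
proof -
  have "{n \<in> {1..N}. e dvd n} \<subseteq> (\<lambda>j. e * j) ` {1..N div e}"
  proof
    fix n assume n: "n \<in> {n \<in> {1..N}. e dvd n}"
    then obtain j where j: "n = e * j" by (auto simp: dvd_def)
    then have "j \<le> N div e" using n assms by (simp add: less_eq_div_iff_mult_less_eq mult.commute)
    then show "n \<in> (\<lambda>j. e * j) ` {1..N div e}" using j n by (auto simp: Suc_le_eq)
  qed
  then have "card {n \<in> {1..N}. e dvd n} \<le> card {1..N div e}"
    by (meson card_image_le card_mono finite_atLeastAtMost finite_imageI order_trans)
  then have "real (card {n \<in> {1..N}. e dvd n}) \<le> real (N div e)" by simp
  also have "\<dots> \<le> real N / real e" by (rule of_nat_div_le_of_nat)
  finally show ?thesis .
qed

section \<open>Mean values of periodic functions\<close>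

lemma sum_periodic:
  fixes g :: "nat \<Rightarrow> real"
  assumes per: "\<And>n. g (n + M) = g n"
  shows "(\<Sum>n=1..N + M. g n) = (\<Sum>n=1..N. g n) + (\<Sum>n=1..M. g n)"
proof (induction N)
  case (Suc N)
  have "(\<Sum>n=1..Suc N + M. g n) = (\<Sum>n=1..N + M. g n) + g (Suc N + M)" by simp
  also have "g (Suc N + M) = g (Suc N)" by (rule per)
  finally show ?case using Suc by simp
qed simp

text \<open>Subtracting the linear trend \<open>c * N\<close> from the partial sums leaves a
  periodic, hence bounded, function; so the means tend to \<open>c\<close>.\<close>

lemma periodic_mean_convergent:
  fixes g :: "nat \<Rightarrow> real"
  assumes per: "\<And>n. g (n + M) = g n" and M: "M > 0"
  shows "convergent (\<lambda>N. (\<Sum>n=1..N. g n) / real N)"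
proof -
  define c where "c = (\<Sum>n=1..M. g n) / real M"
  define h where "h N = (\<Sum>n=1..N. g n) - c * real N" for N
  have h_per: "h (N + M) = h N" for N
    using sum_periodic[of g M N, OF per] M by (simp add: h_def c_def field_simps)
  have h_mod: "h (j * M + r) = h r" for j r
  proof (induction j)
    case (Suc j)
    have "Suc j * M + r = (j * M + r) + M" by simp
    then show ?case using h_per Suc by metis
  qed simp
  define B where "B = Max ((\<lambda>N. \<bar>h N\<bar>) ` {..<M})"
  have bound: "\<bar>h N\<bar> \<le> B" for N
  proof -
    have "h N = h (N mod M)" using h_mod[of "N div M" "N mod M"] by simp
    then show ?thesis unfolding B_def using M by (intro Max_ge) auto
  qed
  have "(\<lambda>N. h N / real N) \<longlonglongrightarrow> 0"
  proof (rule tendsto_0_le[where K = 1])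
    show "(\<lambda>N. B / real N) \<longlonglongrightarrow> 0" by (rule lim_const_over_n)
    have "B \<ge> 0" using bound[of 0] by linarith
    then show "\<forall>\<^sub>F N in sequentially. norm (h N / real N) \<le> norm (B / real N) * 1"
      using bound by (intro always_eventually allI) (simp add: divide_right_mono)
  qed
  then have "(\<lambda>N. h N / real N + c) \<longlonglongrightarrow> 0 + c" by (intro tendsto_intros)
  moreover have "\<forall>\<^sub>F N in sequentially. h N / real N + c = (\<Sum>n=1..N. g n) / real N"
    using eventually_gt_at_top[of 0] by eventually_elim (simp add: h_def field_simps)
  ultimately have "(\<lambda>N. (\<Sum>n=1..N. g n) / real N) \<longlonglongrightarrow> 0 + c"
    by (rule Lim_transform_eventually)
  then show ?thesis by (rule convergentI)
qed

section \<open>Approximation in mean by periodic functions\<close>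

text \<open>If \<open>p ^ i\<close> divides \<open>n\<close> and \<open>M\<close>, it divides their
  gcd, and the factor \<open>p\<close> of the cofactor supplies the next power. This confines the
  \<open>n\<close> whose cofactor is not prime to \<open>q\<close> to the multiples of
  \<open>p ^ m\<close>.\<close>

lemma prime_power_dvd_of_dvd_div_gcd:
  fixes n M :: nat
  assumes "p ^ m dvd M" "p dvd n div gcd n M"
  shows "p ^ m dvd n"
proof -
  have "i \<le> m \<Longrightarrow> p ^ i dvd n" for i
  proof (induction i)
    case (Suc i)
    then have "p ^ i dvd n" "p ^ i dvd M"
      using assms(1) dvd_trans[OF le_imp_power_dvd[of i m p]] by simp_all
    then have "p ^ i * p dvd gcd n M * (n div gcd n M)"
      using assms(2) by (intro mult_dvd_mono) auto
    then show ?case by (simp add: mult.commute)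
  qed simp
  then show ?thesis by simp
qed

text \<open>The functions \<open>\<lambda>n. f (gcd n M)\<close> are periodic; for suitable \<open>M\<close> they approximate \<open>f\<close>
  in mean, uniformly in \<open>N\<close>.\<close>
lemma mean_gcd_approx:
  fixes f :: "nat \<Rightarrow> real"
  assumes q: "primepow q"
    and f01: "\<And>n. n > 0 \<Longrightarrow> 0 \<le> f n \<and> f n \<le> 1"
    and cmp: "\<And>n d. d dvd n \<Longrightarrow> n > 0 \<Longrightarrow> coprime q (n div d) \<Longrightarrow>
      \<bar>f n - f d\<bar> \<le> (\<Sum>e | e dvd n \<and> \<not> e dvd d \<and> coprime q e. real e / real q ^ ord e q)"
  shows "(\<Sum>n=1..N. \<bar>f n - f (gcd n (q ^ m * fact m))\<bar>)
    \<le> (1 / 2 ^ m + (\<Sum>e. ord_weight q (e + Suc m))) * real N"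
proof -
  obtain p l where p: "prime p" "l > 0" "q = p ^ l" using q by (auto simp: primepow_def)
  have q1: "q > 1" using primepow_gt_Suc_0[OF q] by simp
  \<comment> \<open>The factor \<open>q ^ m\<close> makes \<open>p ^ m\<close> divide every
    \<open>n\<close> for which \<open>cmp\<close> does not apply to \<open>gcd n M\<close>; the
    factorial makes every positive \<open>e \<le> m\<close> divide \<open>M\<close>, so that only
    \<open>e > m\<close> enter the error.\<close>
  define M where "M = q ^ m * fact m"
  define w where "w e = real e * ord_weight q e" for e
  have w0: "w e \<ge> 0" for e by (simp add: w_def ord_weight_nonneg)
  have pM: "p ^ m dvd M"
    unfolding M_def p(3) using p(2) by (intro dvd_mult2 dvd_power_same dvd_power) auto
  have M0: "M > 0" using q1 by (simp add: M_def)
  have ptw: "\<bar>f n - f (gcd n M)\<bar>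
      \<le> of_bool (p ^ m dvd n) + (\<Sum>e\<in>{Suc m..N}. if e dvd n then w e else 0)"
    if n: "n \<in> {1..N}" for n
  proof -
    have sum0: "(\<Sum>e\<in>{Suc m..N}. if e dvd n then w e else 0) \<ge> 0" by (intro sum_nonneg) (simp add: w0)
    have g: "gcd n M > 0" using n by simp
    have epos: "e > 0" if "e dvd n" for e using that n by (cases "e = 0") auto
    show ?thesis
    proof (cases "coprime q (n div gcd n M)")
      case False
      then have "\<not> coprime p (n div gcd n M)" using p(2,3) by simp
      then have "p dvd n div gcd n M" using p(1) by (metis prime_imp_coprime)
      then have "p ^ m dvd n" by (rule prime_power_dvd_of_dvd_div_gcd[OF pM])
      moreover have "\<bar>f n - f (gcd n M)\<bar> \<le> 1" using f01[of n] f01[OF g] n by auto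
      ultimately show ?thesis using sum0 by simp
    next
      case True
      have "\<bar>f n - f (gcd n M)\<bar>
          \<le> (\<Sum>e | e dvd n \<and> \<not> e dvd gcd n M \<and> coprime q e. real e / real q ^ ord e q)"
        using True n by (intro cmp) auto
      also have "\<dots> = (\<Sum>e | e dvd n \<and> \<not> e dvd gcd n M \<and> coprime q e. if e dvd n then w e else 0)"
        using epos by (intro sum.cong refl) (simp add: w_def ord_weight_def)
      also have "\<dots> \<le> (\<Sum>e\<in>{Suc m..N}. if e dvd n then w e else 0)"
      proof (rule sum_mono2)
        show "{e. e dvd n \<and> \<not> e dvd gcd n M \<and> coprime q e} \<subseteq> {Suc m..N}"
        proof clarify
          fix e assume e: "e dvd n" "\<not> e dvd gcd n M"
          have "e \<le> n" using e(1) n by (intro dvd_imp_le) auto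
          have "\<not> e dvd M" using e by auto
          have "\<not> e \<le> m"
          proof
            assume "e \<le> m"
            then have "e dvd fact m" using epos[OF e(1)] by (intro dvd_fact) auto
            then show False using \<open>\<not> e dvd M\<close> unfolding M_def by (simp add: dvd_mult)
          qed
          then show "e \<in> {Suc m..N}" using \<open>e \<le> n\<close> n by simp
        qed
      qed (auto simp: w0)
      finally show ?thesis by simp
    qed
  qed
  have "(\<Sum>n=1..N. \<bar>f n - f (gcd n M)\<bar>)
      \<le> (\<Sum>n=1..N. of_bool (p ^ m dvd n) + (\<Sum>e\<in>{Suc m..N}. if e dvd n then w e else 0))"
    by (intro sum_mono ptw)
  also have "\<dots> = (\<Sum>n=1..N. of_bool (p ^ m dvd n)) + (\<Sum>n=1..N. \<Sum>e\<in>{Suc m..N}. if e dvd n then w e else 0)"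
    by (rule sum.distrib)
  also have "(\<Sum>n=1..N. of_bool (p ^ m dvd n)) = real (card {n \<in> {1..N}. p ^ m dvd n})"
    by (simp add: of_bool_def sum.If_cases Int_def)
  also have "\<dots> \<le> real N / real (p ^ m)"
    using p(1) by (intro card_multiples_le) (simp add: prime_gt_0_nat)
  also have "\<dots> \<le> real N / 2 ^ m"
    using prime_ge_2_nat[OF p(1)] by (intro divide_left_mono) (simp_all add: power_mono)
  \<comment> \<open>After the exchange each \<open>e\<close> is counted once for each of its at most
    \<open>N / e\<close> multiples, which cancels the factor \<open>e\<close> in
    \<open>w e\<close>.\<close>
  also have "(\<Sum>n=1..N. \<Sum>e\<in>{Suc m..N}. if e dvd n then w e else 0)
      = (\<Sum>e\<in>{Suc m..N}. \<Sum>n=1..N. if e dvd n then w e else 0)"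
    by (rule sum.swap)
  also have "\<dots> \<le> (\<Sum>e\<in>{Suc m..N}. ord_weight q e * real N)"
  proof (rule sum_mono)
    fix e assume "e \<in> {Suc m..N}"
    then have e: "e > 0" by simp
    have "(\<Sum>n=1..N. if e dvd n then w e else 0) = w e * real (card {n \<in> {1..N}. e dvd n})"
      by (simp add: sum.If_cases Int_def)
    also have "\<dots> \<le> w e * (real N / real e)"
      using card_multiples_le[OF e] w0 by (rule mult_left_mono)
    also have "\<dots> = ord_weight q e * real N" using e by (simp add: w_def)
    finally show "(\<Sum>n=1..N. if e dvd n then w e else 0) \<le> ord_weight q e * real N" .
  qed
  also have "\<dots> = (\<Sum>e\<in>{Suc m..N}. ord_weight q e) * real N" by (simp add: sum_distrib_right)
  also have "\<dots> \<le> (\<Sum>e. ord_weight q (e + Suc m)) * real N"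
  proof (rule mult_right_mono)
    have sm: "summable (\<lambda>e. ord_weight q (e + Suc m))"
      using summable_ord_weight[OF q1] by (rule summable_ignore_initial_segment)
    have "(\<Sum>e\<in>{Suc m..N}. ord_weight q e) \<le> (\<Sum>e\<in>(\<lambda>e. e + Suc m) ` {..<N}. ord_weight q e)"
    proof (rule sum_mono2)
      show "{Suc m..N} \<subseteq> (\<lambda>e. e + Suc m) ` {..<N}"
      proof
        fix e assume "e \<in> {Suc m..N}"
        then show "e \<in> (\<lambda>e. e + Suc m) ` {..<N}" by (intro image_eqI[of _ _ "e - Suc m"]) auto
      qed
    qed (auto simp: ord_weight_nonneg)
    also have "\<dots> = (\<Sum>e<N. ord_weight q (e + Suc m))"
      by (subst sum.reindex) (simp_all add: inj_on_def)
    also have "\<dots> \<le> (\<Sum>e. ord_weight q (e + Suc m))"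
      using sm by (intro sum_le_suminf) (auto simp: ord_weight_nonneg)
    finally show "(\<Sum>e\<in>{Suc m..N}. ord_weight q e) \<le> (\<Sum>e. ord_weight q (e + Suc m))" .
  qed simp
  finally show ?thesis by (simp add: M_def algebra_simps)
qed

text \<open>The means \<open>A N\<close> differ from the means \<open>G m N\<close> of a periodic
  function by at most \<open>\<epsilon> m\<close>, uniformly in \<open>N\<close>. Since
  \<open>G m\<close> converges and \<open>\<epsilon>\<close> tends to 0, \<open>A\<close> is
  Cauchy.\<close>

lemma mean_convergent:
  fixes f :: "nat \<Rightarrow> real"
  assumes q: "primepow q"
    and f01: "\<And>n. n > 0 \<Longrightarrow> 0 \<le> f n \<and> f n \<le> 1"
    and cmp: "\<And>n d. d dvd n \<Longrightarrow> n > 0 \<Longrightarrow> coprime q (n div d) \<Longrightarrow>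
      \<bar>f n - f d\<bar> \<le> (\<Sum>e | e dvd n \<and> \<not> e dvd d \<and> coprime q e. real e / real q ^ ord e q)"
  shows "convergent (\<lambda>N. (\<Sum>n=1..N. f n) / real N)"
proof -
  have q1: "q > 1" using primepow_gt_Suc_0[OF q] by simp
  define A where "A N = (\<Sum>n=1..N. f n) / real N" for N
  define G where "G m N = (\<Sum>n=1..N. f (gcd n (q ^ m * fact m))) / real N" for m N
  define \<epsilon> where "\<epsilon> m = 1 / 2 ^ m + (\<Sum>e. ord_weight q (e + Suc m))" for m
  have eps0: "\<epsilon> m \<ge> 0" for m
    unfolding \<epsilon>_def using summable_ord_weight[OF q1]
    by (intro add_nonneg_nonneg suminf_nonneg summable_ignore_initial_segment) (auto simp: ord_weight_nonneg)
  have AG: "\<bar>A N - G m N\<bar> \<le> \<epsilon> m" for m N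
  proof (cases "N = 0")
    case False
    have "\<bar>(\<Sum>n=1..N. f n) - (\<Sum>n=1..N. f (gcd n (q ^ m * fact m)))\<bar>
        \<le> (\<Sum>n=1..N. \<bar>f n - f (gcd n (q ^ m * fact m))\<bar>)"
      unfolding sum_subtractf[symmetric] by (rule sum_abs)
    also have "\<dots> \<le> \<epsilon> m * real N" unfolding \<epsilon>_def by (rule mean_gcd_approx[OF assms])
    finally show ?thesis using False
      unfolding A_def G_def by (simp add: pos_divide_le_eq flip: diff_divide_distrib)
  qed (simp add: A_def G_def eps0)
  have "\<epsilon> \<longlonglongrightarrow> 0 + 0" unfolding \<epsilon>_def
  proof (intro tendsto_add)
    show "(\<lambda>m. 1 / 2 ^ m :: real) \<longlonglongrightarrow> 0" by real_asymp
    note sm = summable_ord_weight[OF q1]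
    have "(\<lambda>m. suminf (ord_weight q) - (\<Sum>e<m. ord_weight q e)) \<longlonglongrightarrow> suminf (ord_weight q) - suminf (ord_weight q)"
      by (intro tendsto_diff tendsto_const summable_LIMSEQ[OF sm])
    then have "(\<lambda>m. \<Sum>e. ord_weight q (e + m)) \<longlonglongrightarrow> 0"
      by (simp add: suminf_minus_initial_segment[OF sm])
    then show "(\<lambda>m. \<Sum>e. ord_weight q (e + Suc m)) \<longlonglongrightarrow> 0"
      by (rule LIMSEQ_Suc)
  qed
  then have eps: "\<epsilon> \<longlonglongrightarrow> 0" by simp
  have "Cauchy A"
  proof (rule metric_CauchyI)
    fix r :: real assume r: "r > 0"
    then have "\<forall>\<^sub>F m in sequentially. \<epsilon> m < r / 3" using eps by (intro order_tendstoD(2)) auto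
    then obtain m where m: "\<epsilon> m < r / 3" by (auto simp: eventually_sequentially)
    define M where "M = q ^ m * (fact m :: nat)"
    have "convergent (G m)" unfolding G_def M_def[symmetric]
    proof (rule periodic_mean_convergent)
      show "f (gcd (n + M) M) = f (gcd n M)" for n by simp
      show "M > 0" using q1 by (simp add: M_def)
    qed
    then have "Cauchy (G m)" by (simp add: Cauchy_convergent_iff)
    then obtain N0 where N0: "\<And>N N'. N \<ge> N0 \<Longrightarrow> N' \<ge> N0 \<Longrightarrow> dist (G m N) (G m N') < r / 3"
      using metric_CauchyD[of "G m" "r / 3"] r by auto
    show "\<exists>N0. \<forall>N\<ge>N0. \<forall>N'\<ge>N0. dist (A N) (A N') < r"
    proof (intro exI allI impI)
      fix N N' assume "N \<ge> N0" "N' \<ge> N0"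
      then show "dist (A N) (A N') < r"
        using N0[of N N'] AG[of N m] AG[of N' m] m unfolding dist_real_def by linarith
    qed
  qed
  then show ?thesis unfolding A_def by (simp add: Cauchy_convergent_iff)
qed

section \<open>The limit over real \<open>t\<close>\<close>

text \<open>The sum up to \<open>t\<close> is the sum up to its floor, and the ratio of the floor to
  \<open>t\<close> tends to 1.\<close>

lemma mean_tendsto_real:
  fixes f :: "nat \<Rightarrow> real"
  assumes "(\<lambda>N. (\<Sum>n=1..N. f n) / real N) \<longlonglongrightarrow> L"
  shows "((\<lambda>t::real. 1 / t * (\<Sum>n | 1 \<le> n \<and> real n \<le> t. f n)) \<longlongrightarrow> L) at_top"
proof -
  define A where "A N = (\<Sum>n=1..N. f n) / real N" for N
  have lim: "filterlim (\<lambda>t::real. nat \<lfloor>t\<rfloor>) sequentially at_top" by real_asymp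
  have "((\<lambda>t::real. A (nat \<lfloor>t\<rfloor>)) \<longlongrightarrow> L) at_top"
    using assms lim unfolding A_def by (rule filterlim_compose)
  moreover have "((\<lambda>t::real. real (nat \<lfloor>t\<rfloor>) / t) \<longlongrightarrow> 1) at_top" by real_asymp
  ultimately have "((\<lambda>t::real. real (nat \<lfloor>t\<rfloor>) / t * A (nat \<lfloor>t\<rfloor>)) \<longlongrightarrow> 1 * L) at_top"
    by (intro tendsto_mult)
  moreover have "\<forall>\<^sub>F t::real in at_top. real (nat \<lfloor>t\<rfloor>) / t * A (nat \<lfloor>t\<rfloor>)
      = 1 / t * (\<Sum>n | 1 \<le> n \<and> real n \<le> t. f n)"
    using eventually_ge_at_top[of 1]
  proof eventually_elim
    case (elim t)
    have "{n. 1 \<le> n \<and> real n \<le> t} = {1..nat \<lfloor>t\<rfloor>}"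
      using elim by (auto simp: le_nat_floor) linarith
    moreover have "nat \<lfloor>t\<rfloor> \<noteq> 0" using elim by simp
    ultimately show ?case by (simp add: A_def)
  qed
  ultimately have "((\<lambda>t::real. 1 / t * (\<Sum>n | 1 \<le> n \<and> real n \<le> t. f n)) \<longlongrightarrow> 1 * L) at_top"
    by (rule Lim_transform_eventually)
  then show ?thesis by simp
qed

theorem theorem1p1:
  fixes q k :: nat
  assumes "primepow q"
  shows "\<exists>L::real. L \<ge> 0 \<and>
    (\<forall>(K :: nat \<Rightarrow> ('a, 'b) ring_scheme) F.
      (\<forall>n\<ge>1. finite_field_ext q n (K n) (F n)) \<longrightarrow>
      ((\<lambda>t::real. 1 / t * (\<Sum>n | 1 \<le> n \<and> real n \<le> t. k_normal_density q n k (K n) (F n)))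
        \<longlongrightarrow> L) at_top)"
proof (cases "\<exists>(K :: nat \<Rightarrow> ('a, 'b) ring_scheme) F. \<forall>n\<ge>1. finite_field_ext q n (K n) (F n)")
  case False
  \<comment> \<open>If the types admit no such family of fields, the claim about families is vacuous
    and 0 serves as \<open>L\<close>.\<close>
  then show ?thesis by (intro exI[of _ 0]) blast
next
  case True
  then obtain K :: "nat \<Rightarrow> ('a, 'b) ring_scheme" and F
    where "\<And>n. n \<ge> 1 \<Longrightarrow> finite_field_ext q n (K n) (F n)" by blast
  then have ext: "finite_ext (K n) (F n) q n" if "n > 0" for n
    using that assms by (simp add: finite_ext_iff)
  define f where "f n = k_normal_density q n k (K n) (F n)" for n
  have f01: "0 \<le> f n \<and> f n \<le> 1" if "n > 0" for n
    unfolding f_def by (rule finite_ext.k_normal_density_bounds[OF ext[OF that]])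
  have "convergent (\<lambda>N. (\<Sum>n=1..N. f n) / real N)"
  proof (rule mean_convergent[OF assms f01])
    fix n d :: nat assume d: "d dvd n" "n > 0" "coprime q (n div d)"
    then have d0: "d > 0" by (auto intro!: Nat.gr0I)
    note E = ext[OF d(2)]
    \<comment> \<open>The value \<open>f d\<close> belongs to the field chosen for \<open>d\<close>,
      which is unrelated to \<open>K n\<close>; uniqueness identifies it with the intermediate field
      of \<open>K n\<close>.\<close>
    have "f d = k_normal_density q d k (K n\<lparr>carrier := finite_ext.fixed_pts (K n) q d\<rparr>) (F n)"
      unfolding f_def
      by (rule k_normal_density_unique[OF ext[OF d0] finite_ext.finite_ext_fixed_pts[OF E d(1) d0]])
    then show "\<bar>f n - f d\<bar> \<le> (\<Sum>e | e dvd n \<and> \<not> e dvd d \<and> coprime q e. real e / real q ^ ord e q)"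
      using finite_ext.density_compare[OF E d(1) d0 d(3)] unfolding f_def by simp
  qed auto
  then obtain L where L: "(\<lambda>N. (\<Sum>n=1..N. f n) / real N) \<longlonglongrightarrow> L" by (auto simp: convergent_def)
  have "L \<ge> 0"
    using f01 by (intro LIMSEQ_le_const[OF L] exI[of _ 0]) (auto intro!: divide_nonneg_nonneg sum_nonneg)
  moreover have "((\<lambda>t::real. 1 / t * (\<Sum>n | 1 \<le> n \<and> real n \<le> t. k_normal_density q n k (K' n) (F' n)))
        \<longlongrightarrow> L) at_top"
    if "\<forall>n\<ge>1. finite_field_ext q n (K' n) (F' n)" for K' :: "nat \<Rightarrow> ('a, 'b) ring_scheme" and F'
  proof -
    \<comment> \<open>Any other family has the same densities, so one \<open>L\<close> serves all
      families.\<close>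
    have "k_normal_density q n k (K' n) (F' n) = f n" if "1 \<le> n" for n
      unfolding f_def using that \<open>\<forall>n\<ge>1. _ n\<close> assms
      by (intro k_normal_density_unique ext) (simp_all add: finite_ext_iff)
    then show ?thesis using mean_tendsto_real[OF L] by (simp cong: conj_cong)
  qed
  ultimately show ?thesis by blast
qed

end
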